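(* Let $\mathbb S$ be the free semigroup action on the compact metric space $(X,d)$ generated by continuous maps $g_1,\dots,g_p$, and let $\nu\in\mathcal M_1(X)$ with $\Pi(\sigma,\nu)_{erg}\neq\emptyset$. Then $$\liminf_{\varepsilon\to0}\,\inf\{S_d(K,\mathbb S,\varepsilon):K\in\mathcal B_X,\ \nu(K)>0\}\ \ge\ h_\nu(\mathbb S).$$ In particular, $h_{top}(K,\mathbb S)\ge h_\nu(\mathbb S)$ for every Borel set $K\subset X$ with $\nu(K)>0$.
   Context: Setting: $(X,d)$ compact metric space, $g_1,\dots,g_p:X\to X$ continuous, $G_n^*$ the set of all words $\underline g=g_{i_n}\cdots g_{i_1}$, $i_j\in\{1,\dots,p\}$ ($p^n$ words). $d_{\underline g}(x,y)=\max_{0\le j\le n}d(g_{i_j}\cdots g_{i_1}x,g_{i_j}\cdots g_{i_1}y)$. $s(K,\underline g,\varepsilon)$: maximal cardinality of a subset of $K$ whose distinct points are at $d_{\underline g}$-distance $>\varepsilon$. $S_n(K,\mathbb S,\varepsilon)=p^{-n}\sum_{\underline g\in G_n^*}s(K,\underline g,\varepsilon)$, $S_d(K,\mathbb S,\varepsilon)=\limsup_{n\to\infty}\frac1n\log S_n(K,\mathbb S,\varepsilon)$, $h_{top}(K,\mathbb S)=\lim_{\varepsilon\to0}S_d(K,\mathbb S,\varepsilon)$. $\mathcal B_X$ is the Borel $\sigma$-algebra. Skew product: $\Sigma_p^+=\{1,\dots,p\}^{\mathbb N}$, shift $\sigma$, $\mathcal F_G(\omega,x)=(\sigma\omega,g_{\omega_1}(x))$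 on $\Sigma_p^+\times X$. $\Pi(\sigma,\nu)$: $\mathcal F_G$-invariant Borel probabilities $\mu$ on $\Sigma_p^+\times X$ with $(\pi_{\Sigma_p^+})_*\mu$ $\sigma$-invariant and $(\pi_X)_*\mu=\nu$; $\Pi(\sigma,\nu)_{erg}$ its ergodic elements. $h_\nu(\mathbb S)=\sup_{\mu\in\Pi(\sigma,\nu)}h_\mu(\mathcal F_G)-\log p$. *)

theory Defs
  imports "HOL-Probability.Probability"
begin

text \<open>Generators are indexed by 0..p-1 (the paper uses 1..p). A word of length n
  is a list [i_1,...,i_n]; the map g_{i_1} is applied first.\<close>

definition words :: "nat \<Rightarrow> nat \<Rightarrow> nat list set" where
  "words p n = {ws. length ws = n \<and> set ws \<subseteq> {..<p}}"

definition orbit_pt :: "(nat \<Rightarrow> 'a \<Rightarrow> 'a) \<Rightarrow> nat list \<Rightarrow> nat \<Rightarrow> 'a \<Rightarrow> 'a" where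
  "orbit_pt g ws j x = foldl (\<lambda>y i. g i y) x (take j ws)"

definition dword :: "(nat \<Rightarrow> 'a::metric_space \<Rightarrow> 'a) \<Rightarrow> nat list \<Rightarrow> 'a \<Rightarrow> 'a \<Rightarrow> real" where
  "dword g ws x y = Max {dist (orbit_pt g ws j x) (orbit_pt g ws j y) | j. j \<le> length ws}"

definition sep_card :: "(nat \<Rightarrow> 'a::metric_space \<Rightarrow> 'a) \<Rightarrow> 'a set \<Rightarrow> nat list \<Rightarrow> real \<Rightarrow> nat" where
  "sep_card g K ws \<epsilon> = Sup {card E | E. E \<subseteq> K \<and> finite E \<and>
       (\<forall>x\<in>E. \<forall>y\<in>E. x \<noteq> y \<longrightarrow> dword g ws x y > \<epsilon>)}"

definition S_n :: "nat \<Rightarrow> (nat \<Rightarrow> 'a::metric_space \<Rightarrow> 'a) \<Rightarrow> 'a set \<Rightarrow> real \<Rightarrow> nat \<Rightarrow> real" where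
  "S_n p g K \<epsilon> n = (\<Sum>ws\<in>words p n. real (sep_card g K ws \<epsilon>)) / real p ^ n"

definition S_d :: "nat \<Rightarrow> (nat \<Rightarrow> 'a::metric_space \<Rightarrow> 'a) \<Rightarrow> 'a set \<Rightarrow> real \<Rightarrow> ereal" where
  "S_d p g K \<epsilon> = limsup (\<lambda>n. ereal (ln (S_n p g K \<epsilon> n) / real n))"

definition h_top :: "nat \<Rightarrow> (nat \<Rightarrow> 'a::metric_space \<Rightarrow> 'a) \<Rightarrow> 'a set \<Rightarrow> ereal" where
  "h_top p g K = Lim (at_right 0) (\<lambda>\<epsilon>. S_d p g K \<epsilon>)"

text \<open>Skew product. Sigma_p^+ = {0..p-1}^N with the product sigma-algebra (= Borel).\<close>
definition shift_space :: "nat \<Rightarrow> (nat \<Rightarrow> nat) measure" where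
  "shift_space p = PiM UNIV (\<lambda>_. count_space {..<p})"

definition skew_space :: "nat \<Rightarrow> 'a::topological_space set \<Rightarrow> ((nat \<Rightarrow> nat) \<times> 'a) measure" where
  "skew_space p X = shift_space p \<Otimes>\<^sub>M restrict_space borel X"

definition shift :: "(nat \<Rightarrow> nat) \<Rightarrow> (nat \<Rightarrow> nat)" where
  "shift \<omega> = (\<lambda>i. \<omega> (Suc i))"

definition skew_map :: "(nat \<Rightarrow> 'a \<Rightarrow> 'a) \<Rightarrow> (nat \<Rightarrow> nat) \<times> 'a \<Rightarrow> (nat \<Rightarrow> nat) \<times> 'a" where
  "skew_map g = (\<lambda>(\<omega>, x). (shift \<omega>, g (\<omega> 0) x))"

definition invariant_measure :: "'b measure \<Rightarrow> ('b \<Rightarrow> 'b) \<Rightarrow> bool" where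
  "invariant_measure \<mu> T \<longleftrightarrow> T \<in> measurable \<mu> \<mu> \<and> distr \<mu> \<mu> T = \<mu>"

definition ergodic :: "'b measure \<Rightarrow> ('b \<Rightarrow> 'b) \<Rightarrow> bool" where
  "ergodic \<mu> T \<longleftrightarrow> invariant_measure \<mu> T \<and>
     (\<forall>A\<in>sets \<mu>. T -` A \<inter> space \<mu> = A \<longrightarrow> measure \<mu> A = 0 \<or> measure \<mu> A = 1)"

definition Pi_set :: "nat \<Rightarrow> 'a::topological_space set \<Rightarrow> (nat \<Rightarrow> 'a \<Rightarrow> 'a) \<Rightarrow> 'a measure
    \<Rightarrow> ((nat \<Rightarrow> nat) \<times> 'a) measure set" where
  "Pi_set p X g \<nu> = {\<mu>. sets \<mu> = sets (skew_space p X) \<and> prob_space \<mu> \<and>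
      invariant_measure \<mu> (skew_map g) \<and>
      invariant_measure (distr \<mu> (shift_space p) fst) shift \<and>
      distr \<mu> (restrict_space borel X) snd = \<nu>}"

definition Pi_erg :: "nat \<Rightarrow> 'a::topological_space set \<Rightarrow> (nat \<Rightarrow> 'a \<Rightarrow> 'a) \<Rightarrow> 'a measure
    \<Rightarrow> ((nat \<Rightarrow> nat) \<times> 'a) measure set" where
  "Pi_erg p X g \<nu> = {\<mu>\<in>Pi_set p X g \<nu>. ergodic \<mu> (skew_map g)}"

definition finite_partition :: "'b measure \<Rightarrow> 'b set set \<Rightarrow> bool" where
  "finite_partition \<mu> P \<longleftrightarrow> finite P \<and> P \<subseteq> sets \<mu> \<and> \<Union>P = space \<mu> \<and>
     (\<forall>A\<in>P. \<forall>B\<in>P. A \<noteq> B \<longrightarrow> A \<inter> B = {})"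

definition partition_entropy :: "'b measure \<Rightarrow> 'b set set \<Rightarrow> real" where
  "partition_entropy \<mu> P = - (\<Sum>A\<in>P. measure \<mu> A * ln (measure \<mu> A))"

definition iter_join :: "'b measure \<Rightarrow> ('b \<Rightarrow> 'b) \<Rightarrow> 'b set set \<Rightarrow> nat \<Rightarrow> 'b set set" where
  "iter_join \<mu> T P n = {space \<mu> \<inter> (\<Inter>i<n. (T ^^ i) -` c i) | c. \<forall>i<n. c i \<in> P}"

definition entropy_wrt :: "'b measure \<Rightarrow> ('b \<Rightarrow> 'b) \<Rightarrow> 'b set set \<Rightarrow> real" where
  "entropy_wrt \<mu> T P = lim (\<lambda>n. partition_entropy \<mu> (iter_join \<mu> T P n) / real n)"

definition ks_entropy :: "'b measure \<Rightarrow> ('b \<Rightarrow> 'b) \<Rightarrow> ereal" where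
  "ks_entropy \<mu> T = (SUP P\<in>{P. finite_partition \<mu> P}. ereal (entropy_wrt \<mu> T P))"

definition h_nu :: "nat \<Rightarrow> 'a::topological_space set \<Rightarrow> (nat \<Rightarrow> 'a \<Rightarrow> 'a) \<Rightarrow> 'a measure \<Rightarrow> ereal" where
  "h_nu p X g \<nu> = (SUP \<mu>\<in>Pi_set p X g \<nu>. ks_entropy \<mu> (skew_map g)) - ereal (ln (real p))"

end

theory Submission
  imports Defs
begin

text \<open>Ergodicity is used only through the marginal: if F \<subseteq> K is compact with \<nu>(F) > 0, then the union of
  the images of F under all words is forward invariant, hence has full \<nu>-measure, and the words of length at
  most m already give measure close to 1. Let now \<mu> \<in> \<Pi>(\<sigma>, \<nu>) be arbitrary and let P be a finite partition. By a
  Lusin argument the atom of P is decided, off a set of small \<mu>-measure, by finitely many symbols and an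
  approximate position. A point over g_w y with y \<in> F continues the orbit of y along the word w, so up to few
  errors its P-name of length n is determined by a word of length n + O(1) and by a point of a maximal separated
  subset of K for that word. This gives at most p^n S_n(K, \<epsilon>) e^{o(n)} names, up to a Hamming ball of small
  exponential size, on a set of \<mu>-measure close to 1, which bounds the entropy of P. The bound for \<epsilon> depends on \<mu>
  and P but not on K.\<close>

section \<open>Entropy of finite partitions\<close>

text \<open>The points over K may have small \<mu>-measure, and \<mu> itself need not be ergodic, so
  orbits that start in K need not be typical for \<mu>. What \<mu> shares with the ergodic measure
  is the marginal \<nu>, and this is enough to place all but a small set of points over word images
  of F. Compactness of F keeps these images measurable; the image of a Borel set might fail to be
  Borel. Apart from \<open>S_n\<close>, the set K enters only through m, which lengthens the words
  by a bounded amount and disappears after division by n; hence a threshold for \<epsilon> that is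
  uniform in K. The term ln p in \<open>h_nu\<close> comes from counting pairs of a word and a
  separated point, since the sum over words of length L is p^L times \<open>S_n\<close>. Visits to
  the exceptional set are controlled by Markov's inequality, not by convergence of frequencies.
  Hamming balls are counted with weights t^d for a fixed t, which gives the rate k t + 2 \<eta> ln
  (1/t), where k is the number of atoms; t has to be chosen before \<eta>.\<close>

lemma subadditive_convergent:
  fixes a :: "nat \<Rightarrow> real"
  assumes sub: "\<And>m n. a (m + n) \<le> a m + a n" and nonneg: "\<And>n. 0 \<le> a n"
  shows "convergent (\<lambda>n. a n / real n)"
proof -
  define L where "L = (INF n\<in>{1..}. a n / real n)"
  have bdd: "bdd_below ((\<lambda>n. a n / real n) ` {1..})"
    by (rule bdd_belowI2[of _ 0]) (simp add: nonneg)
  have mult: "a (q * s + r) \<le> real s * a q + a r" for q s r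
  proof (induction s)
    case (Suc s)
    have "a (q * Suc s + r) = a (q + (q * s + r))" by (simp add: algebra_simps)
    also have "\<dots> \<le> a q + a (q * s + r)" by (rule sub)
    finally show ?case using Suc by (simp add: algebra_simps)
  qed simp
  have "(\<lambda>n. a n / real n) \<longlonglongrightarrow> L"
  proof (rule order_tendstoI)
    fix c assume "c < L"
    have "c < a n / real n" if "n \<ge> 1" for n
    proof -
      have "L \<le> a n / real n"
        unfolding L_def by (rule cINF_lower[OF bdd]) (use that in auto)
      with \<open>c < L\<close> show ?thesis by simp
    qed
    then show "\<forall>\<^sub>F n in sequentially. c < a n / real n"
      by (auto simp: eventually_sequentially)
  next
    fix c assume "L < c"
    then obtain q :: nat where q: "q \<ge> 1" "a q / real q < c"
      unfolding L_def using cINF_less_iff[OF _ bdd] by auto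
    \<comment> \<open>The remainder n mod q is one of finitely many indices, and since all terms are
      nonnegative their sum bounds each of them.\<close>
    define M where "M = (\<Sum>r<q. a r)"
    have le: "a n / real n \<le> a q / real q + M / real n" if "n \<ge> 1" for n
    proof -
      have "a n \<le> real (n div q) * a q + a (n mod q)"
        using mult[of q "n div q" "n mod q"] by simp
      moreover have "a (n mod q) \<le> M"
        unfolding M_def using q nonneg by (intro member_le_sum) auto
      moreover have "real (n div q) * a q \<le> real n / real q * a q"
        using nonneg of_nat_div_le_of_nat[of n q] by (intro mult_right_mono) auto
      ultimately have "a n \<le> real n / real q * a q + M" by linarith
      then have "a n / real n \<le> (real n / real q * a q + M) / real n"
        by (rule divide_right_mono) simp
      then show ?thesis using that q by (simp add: add_divide_distrib)
    qed
    have "(\<lambda>n. a q / real q + M / real n) \<longlonglongrightarrow> a q / real q + 0"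
      by (intro tendsto_intros lim_const_over_n)
    then have "\<forall>\<^sub>F n in sequentially. a q / real q + M / real n < c"
      using q(2) by (intro order_tendstoD(2)) auto
    then show "\<forall>\<^sub>F n in sequentially. a n / real n < c"
      using eventually_ge_at_top[of 1]
      by eventually_elim (use le in fastforce)
  qed
  then show ?thesis by (auto simp: convergent_def)
qed

text \<open>This is ln x \<le> x - 1 at x = q / a, summed with weights a. Since
  \<open>ln 0 = 0\<close> here, an index with q = 0 < a would drop out of the right side instead of
  making it infinite; the condition on zeros of q excludes this.\<close>

lemma Gibbs_inequality:
  fixes a q :: "'i \<Rightarrow> real"
  assumes "finite I" "\<And>i. i \<in> I \<Longrightarrow> a i \<ge> 0" "\<And>i. i \<in> I \<Longrightarrow> q i \<ge> 0"
    and "\<And>i. i \<in> I \<Longrightarrow> q i = 0 \<Longrightarrow> a i = 0" and "sum q I \<le> sum a I"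
  shows "- (\<Sum>i\<in>I. a i * ln (a i)) \<le> - (\<Sum>i\<in>I. a i * ln (q i))"
proof -
  have "a i * ln (q i) - a i * ln (a i) \<le> q i - a i" if "i \<in> I" for i
  proof (cases "a i = 0")
    case False
    with that assms have pos: "a i > 0" "q i > 0" by (metis order_less_le)+
    have "ln (q i / a i) \<le> q i / a i - 1" using pos by (intro ln_le_minus_one) auto
    then have "a i * ln (q i / a i) \<le> a i * (q i / a i - 1)"
      using pos by (intro mult_left_mono) auto
    then show ?thesis using pos by (simp add: ln_div algebra_simps)
  qed (use assms that in auto)
  then have "(\<Sum>i\<in>I. a i * ln (q i) - a i * ln (a i)) \<le> (\<Sum>i\<in>I. q i - a i)"
    by (rule sum_mono)
  then show ?thesis using assms(5) by (simp add: sum_subtractf)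
qed

lemma sum_measure_finite_partition:
  assumes "prob_space \<mu>" "finite_partition \<mu> P" "A \<in> sets \<mu>"
  shows "(\<Sum>B\<in>P. measure \<mu> (A \<inter> B)) = measure \<mu> A"
proof -
  interpret prob_space \<mu> by fact
  have P: "finite P" "P \<subseteq> sets \<mu>" "\<Union>P = space \<mu>"
    "\<And>B C. B \<in> P \<Longrightarrow> C \<in> P \<Longrightarrow> B \<noteq> C \<Longrightarrow> B \<inter> C = {}"
    using assms(2) by (auto simp: finite_partition_def)
  have "measure \<mu> (\<Union>B\<in>P. A \<inter> B) = (\<Sum>B\<in>P. measure \<mu> (A \<inter> B))"
  proof (rule finite_measure_finite_Union)
    show "disjoint_family_on ((\<inter>) A) P"
      using P(4) unfolding disjoint_family_on_def by blast
  qed (use P assms(3) in auto)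
  moreover have "(\<Union>B\<in>P. A \<inter> B) = A"
    using P(3) sets.sets_into_space[OF assms(3)] by auto
  ultimately show ?thesis by simp
qed

lemma sum_measure_finite_partition_UNIV:
  assumes "prob_space \<mu>" "finite_partition \<mu> P"
  shows "(\<Sum>B\<in>P. measure \<mu> B) = 1"
proof -
  have "(\<Sum>B\<in>P. measure \<mu> (space \<mu> \<inter> B)) = 1"
    using sum_measure_finite_partition[OF assms sets.top] prob_space.prob_space[OF assms(1)] by simp
  moreover have "space \<mu> \<inter> B = B" if "B \<in> P" for B
    using that assms(2) sets.sets_into_space by (fastforce simp: finite_partition_def)
  ultimately show ?thesis by simp
qed

text \<open>Atoms in \<open>Q'\<close> pay ln N, and the crude price ln C is charged only to the
  mass \<beta> of the others. In the application C is exponential in n, so a fixed small \<beta>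
  costs a small multiple of n.\<close>

lemma partition_entropy_le_card:
  fixes N C \<beta> :: real
  assumes "prob_space \<mu>" "finite_partition \<mu> Q" "Q' \<subseteq> Q"
    and "real (card Q') \<le> N" "1 \<le> N" "real (card Q) \<le> C" "1 \<le> C"
    and "measure \<mu> (\<Union>(Q - Q')) \<le> \<beta>"
  shows "partition_entropy \<mu> Q \<le> ln 2 + ln N + \<beta> * ln C"
proof -
  interpret prob_space \<mu> by fact
  have Q: "finite Q" "Q \<subseteq> sets \<mu>"
    "\<And>A B. A \<in> Q \<Longrightarrow> B \<in> Q \<Longrightarrow> A \<noteq> B \<Longrightarrow> A \<inter> B = {}"
    using assms(2) by (auto simp: finite_partition_def)
  \<comment> \<open>The test distribution for the Gibbs inequality: at most half of its mass lies on
    the at most N atoms of \<open>Q'\<close>, at most half on the others, of which there are at most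
    C. The halving produces the term ln 2.\<close>
  define q where "q A = (if A \<in> Q' then 1 / (2 * N) else 1 / (2 * C))" for A :: "'a set"
  have split: "sum f Q = sum f Q' + sum f (Q - Q')" for f :: "'a set \<Rightarrow> real"
    using sum.subset_diff[OF assms(3) Q(1), of f] by simp
  have "sum q Q = real (card Q') / (2 * N) + real (card (Q - Q')) / (2 * C)"
    unfolding split by (simp add: q_def)
  also have "\<dots> \<le> N / (2 * N) + C / (2 * C)"
  proof (intro add_mono divide_right_mono)
    show "real (card (Q - Q')) \<le> C"
      using assms(6) card_mono[OF Q(1), of "Q - Q'"] by simp
  qed (use assms in auto)
  also have "\<dots> = 1" using assms by simp
  finally have q1: "sum q Q \<le> 1" .
  have s1: "sum (measure \<mu>) Q = 1" by (rule sum_measure_finite_partition_UNIV[OF assms(1,2)])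
  have rest: "sum (measure \<mu>) (Q - Q') \<le> \<beta>"
  proof -
    have "measure \<mu> (\<Union>A\<in>Q - Q'. A) = (\<Sum>A\<in>Q - Q'. measure \<mu> A)"
      by (rule finite_measure_finite_Union)
        (use Q in \<open>auto simp: disjoint_family_on_def\<close>)
    then show ?thesis using assms(8) by simp
  qed
  have "partition_entropy \<mu> Q \<le> - (\<Sum>A\<in>Q. measure \<mu> A * ln (q A))"
    unfolding partition_entropy_def
    by (rule Gibbs_inequality) (use Q q1 s1 assms in \<open>auto simp: q_def split: if_splits\<close>)
  also have "\<dots> = sum (measure \<mu>) Q' * ln (2 * N) + sum (measure \<mu>) (Q - Q') * ln (2 * C)"
    unfolding split using assms by (simp add: q_def ln_div sum_distrib_right sum_negf)
  also have "\<dots> = ln 2 * sum (measure \<mu>) Q + sum (measure \<mu>) Q' * ln N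
      + sum (measure \<mu>) (Q - Q') * ln C"
    unfolding split using assms by (simp add: ln_mult algebra_simps)
  also have "\<dots> \<le> ln 2 * 1 + 1 * ln N + \<beta> * ln C"
  proof (intro add_mono mult_right_mono)
    have "0 \<le> sum (measure \<mu>) (Q - Q')" by (simp add: sum_nonneg)
    then show "sum (measure \<mu>) Q' \<le> 1" using s1 split[of "measure \<mu>"] by linarith
  qed (use s1 rest assms in auto)
  finally show ?thesis by simp
qed

lemma partition_entropy_nonneg:
  assumes "prob_space \<mu>"
  shows "0 \<le> partition_entropy \<mu> P"
proof -
  interpret prob_space \<mu> by fact
  have "measure \<mu> A * ln (measure \<mu> A) \<le> 0" for A
    by (cases "measure \<mu> A = 0")
      (auto simp: mult_le_0_iff ln_le_zero_iff zero_less_measure_iff order_less_le)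
  then show ?thesis unfolding partition_entropy_def by (simp add: sum_nonpos)
qed

definition partition_join :: "'b set set \<Rightarrow> 'b set set \<Rightarrow> 'b set set" where
  "partition_join P Q = (\<lambda>(A, B). A \<inter> B) ` (P \<times> Q)"

lemma finite_partition_join:
  assumes "finite_partition \<mu> P" "finite_partition \<mu> Q"
  shows "finite_partition \<mu> (partition_join P Q)"
  unfolding finite_partition_def
proof (intro conjI ballI impI)
  show "finite (partition_join P Q)" "partition_join P Q \<subseteq> sets \<mu>"
    using assms by (auto simp: finite_partition_def partition_join_def)
  have "\<Union>(partition_join P Q) = \<Union>P \<inter> \<Union>Q"
    unfolding partition_join_def by fastforce
  then show "\<Union>(partition_join P Q) = space \<mu>" using assms by (simp add: finite_partition_def)
  fix A B assume "A \<in> partition_join P Q" "B \<in> partition_join P Q" "A \<noteq> B"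
  then show "A \<inter> B = {}"
    using assms unfolding finite_partition_def partition_join_def by auto blast+
qed

text \<open>Gibbs inequality on P \<times> Q, comparing the joint distribution with the product of
  its marginals; the logarithm of the product splits into the two entropies.\<close>

lemma partition_entropy_join_le:
  assumes "prob_space \<mu>" "finite_partition \<mu> P" "finite_partition \<mu> Q"
  shows "partition_entropy \<mu> (partition_join P Q) \<le> partition_entropy \<mu> P + partition_entropy \<mu> Q"
proof -
  interpret prob_space \<mu> by fact
  have P: "finite P" "P \<subseteq> sets \<mu>" "\<And>A B. A \<in> P \<Longrightarrow> B \<in> P \<Longrightarrow> A \<noteq> B \<Longrightarrow> A \<inter> B = {}"
    using assms(2) by (auto simp: finite_partition_def)
  have Q: "finite Q" "Q \<subseteq> sets \<mu>" "\<And>A B. A \<in> Q \<Longrightarrow> B \<in> Q \<Longrightarrow> A \<noteq> B \<Longrightarrow> A \<inter> B = {}"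
    using assms(3) by (auto simp: finite_partition_def)
  define a where "a = (\<lambda>(A, B). measure \<mu> (A \<inter> B))"
  define q where "q = (\<lambda>(A, B). measure \<mu> A * measure \<mu> B)"
  have row: "(\<Sum>B\<in>Q. measure \<mu> (A \<inter> B)) = measure \<mu> A" if "A \<in> P" for A
    using sum_measure_finite_partition[OF assms(1,3)] that P by auto
  have col: "(\<Sum>A\<in>P. measure \<mu> (A \<inter> B)) = measure \<mu> B" if "B \<in> Q" for B
    using sum_measure_finite_partition[OF assms(1,2), of B] that Q by (auto simp: Int_commute)
  have P1: "sum (measure \<mu>) P = 1" and Q1: "sum (measure \<mu>) Q = 1"
    using sum_measure_finite_partition_UNIV assms by blast+
  have mono: "measure \<mu> (A \<inter> B) \<le> measure \<mu> A" "measure \<mu> (A \<inter> B) \<le> measure \<mu> B"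
    if "A \<in> P" "B \<in> Q" for A B
    using that P Q by (auto intro!: finite_measure_mono)
  have a0: "measure \<mu> A \<noteq> 0" "measure \<mu> B \<noteq> 0"
    if "A \<in> P" "B \<in> Q" "measure \<mu> (A \<inter> B) \<noteq> 0" for A B
    using mono[OF that(1,2)] that(3) measure_nonneg[of \<mu> "A \<inter> B"] by linarith+
  have "partition_entropy \<mu> (partition_join P Q) = - (\<Sum>z\<in>P \<times> Q. a z * ln (a z))"
    unfolding partition_entropy_def partition_join_def
  \<comment> \<open>Different pairs can give the same set only if that set is empty, and then its
    term is 0. So collapsing repeated intersections to one set does not change the sum.\<close>
  proof (subst sum.reindex_nontrivial)
    fix x y assume "x \<in> P \<times> Q" "y \<in> P \<times> Q" "x \<noteq> y"
      "(case x of (A, B) \<Rightarrow> A \<inter> B) = (case y of (A, B) \<Rightarrow> A \<inter> B)"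
    then have "(case x of (A, B) \<Rightarrow> A \<inter> B) = {}"
      using P(3) Q(3) by (cases x; cases y) (auto; blast)
    then show "measure \<mu> (case x of (A, B) \<Rightarrow> A \<inter> B) * ln (measure \<mu> (case x of (A, B) \<Rightarrow> A \<inter> B)) = 0"
      by simp
  qed (use P Q in \<open>auto simp: a_def split_beta\<close>)
  also have "\<dots> \<le> - (\<Sum>z\<in>P \<times> Q. a z * ln (q z))"
  proof (rule Gibbs_inequality)
    show "sum q (P \<times> Q) \<le> sum a (P \<times> Q)"
      using P1 Q1 row by (simp add: q_def a_def sum.cartesian_product[symmetric] sum_distrib_left[symmetric])
    show "a z = 0" if "z \<in> P \<times> Q" "q z = 0" for z
      using that a0 by (force simp: a_def q_def)
  qed (use P Q in \<open>auto simp: a_def q_def\<close>)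
  also have "(\<Sum>z\<in>P \<times> Q. a z * ln (q z))
      = (\<Sum>(A, B)\<in>P \<times> Q. measure \<mu> (A \<inter> B) * ln (measure \<mu> A) + measure \<mu> (A \<inter> B) * ln (measure \<mu> B))"
  proof (rule sum.cong)
    fix z assume "z \<in> P \<times> Q"
    then obtain A B where z: "z = (A, B)" "A \<in> P" "B \<in> Q" by auto
    show "a z * ln (q z) = (case z of (A, B) \<Rightarrow>
        measure \<mu> (A \<inter> B) * ln (measure \<mu> A) + measure \<mu> (A \<inter> B) * ln (measure \<mu> B))"
    proof (cases "measure \<mu> (A \<inter> B) = 0")
      case False
      then have "measure \<mu> A > 0" "measure \<mu> B > 0" using a0[OF z(2,3)] by (auto simp: zero_less_measure_iff)
      then show ?thesis using z(1) by (simp add: a_def q_def ln_mult algebra_simps)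
    qed (simp add: z(1) a_def)
  qed simp
  also have "\<dots> = (\<Sum>A\<in>P. \<Sum>B\<in>Q. measure \<mu> (A \<inter> B) * ln (measure \<mu> A))
      + (\<Sum>A\<in>P. \<Sum>B\<in>Q. measure \<mu> (A \<inter> B) * ln (measure \<mu> B))"
    by (simp add: sum.cartesian_product[symmetric] sum.distrib)
  also have "(\<Sum>A\<in>P. \<Sum>B\<in>Q. measure \<mu> (A \<inter> B) * ln (measure \<mu> B))
      = (\<Sum>B\<in>Q. \<Sum>A\<in>P. measure \<mu> (A \<inter> B) * ln (measure \<mu> B))"
    by (rule sum.swap)
  finally show ?thesis
    using row col by (simp add: partition_entropy_def sum_distrib_right[symmetric])
qed

lemma finite_partition_vimage:
  assumes "finite_partition \<mu> P" "T \<in> measurable \<mu> \<mu>"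
  shows "finite_partition \<mu> ((\<lambda>A. T -` A \<inter> space \<mu>) ` P)"
  unfolding finite_partition_def
proof (intro conjI)
  show "\<Union>((\<lambda>A. T -` A \<inter> space \<mu>) ` P) = space \<mu>"
  proof -
    have "T z \<in> \<Union>P" if "z \<in> space \<mu>" for z
      using measurable_space[OF assms(2) that] assms(1) by (simp add: finite_partition_def)
    then show ?thesis by auto
  qed
  show "\<forall>A\<in>(\<lambda>A. T -` A \<inter> space \<mu>) ` P. \<forall>B\<in>(\<lambda>A. T -` A \<inter> space \<mu>) ` P. A \<noteq> B \<longrightarrow> A \<inter> B = {}"
  proof (intro ballI impI)
    fix C D assume "C \<in> (\<lambda>A. T -` A \<inter> space \<mu>) ` P" "D \<in> (\<lambda>A. T -` A \<inter> space \<mu>) ` P" "C \<noteq> D"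
    then obtain A B where AB: "A \<in> P" "B \<in> P" "C = T -` A \<inter> space \<mu>" "D = T -` B \<inter> space \<mu>"
      by blast
    with \<open>C \<noteq> D\<close> have "A \<inter> B = {}"
      using assms(1) unfolding finite_partition_def by blast
    then show "C \<inter> D = {}" using AB by blast
  qed
qed (use assms in \<open>auto simp: finite_partition_def intro!: measurable_sets\<close>)

lemma partition_entropy_vimage:
  assumes "finite_partition \<mu> P" "T \<in> measurable \<mu> \<mu>" "distr \<mu> \<mu> T = \<mu>"
  shows "partition_entropy \<mu> ((\<lambda>A. T -` A \<inter> space \<mu>) ` P) = partition_entropy \<mu> P"
proof -
  have meas: "measure \<mu> (T -` A \<inter> space \<mu>) = measure \<mu> A" if "A \<in> P" for A
    using measure_distr[OF assms(2), of A] that assms by (auto simp: finite_partition_def)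
  show ?thesis unfolding partition_entropy_def
  proof (subst sum.reindex_nontrivial)
    fix A B assume "A \<in> P" "B \<in> P" "A \<noteq> B" "T -` A \<inter> space \<mu> = T -` B \<inter> space \<mu>"
    moreover from this have "A \<inter> B = {}" using assms(1) by (simp add: finite_partition_def)
    ultimately have "T -` A \<inter> space \<mu> = {}" by blast
    then show "measure \<mu> (T -` A \<inter> space \<mu>) * ln (measure \<mu> (T -` A \<inter> space \<mu>)) = 0" by simp
  qed (use assms meas in \<open>auto simp: finite_partition_def\<close>)
qed

lemma invariant_measure_funpow:
  assumes "invariant_measure \<mu> T"
  shows "invariant_measure \<mu> (T ^^ n)"
proof (induction n)
  case 0
  then show ?case by (simp add: invariant_measure_def distr_id2[of \<mu> \<mu>] id_def distr_id)
next
  case (Suc n)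
  have eq: "T ^^ Suc n = T \<circ> T ^^ n" by simp
  have "distr (distr \<mu> \<mu> (T ^^ n)) \<mu> T = distr \<mu> \<mu> (T \<circ> T ^^ n)"
    by (rule distr_distr) (use Suc assms in \<open>auto simp: invariant_measure_def\<close>)
  moreover have "T \<circ> T ^^ n \<in> measurable \<mu> \<mu>"
    by (rule measurable_comp) (use Suc assms in \<open>auto simp: invariant_measure_def\<close>)
  ultimately show ?case using Suc assms unfolding invariant_measure_def eq by metis
qed

lemma invariant_measure_vimage:
  assumes "invariant_measure \<mu> T" "A \<in> sets \<mu>"
  shows "measure \<mu> (T -` A \<inter> space \<mu>) = measure \<mu> A"
  using measure_distr[of T \<mu> \<mu> A] assms by (simp add: invariant_measure_def)

lemma iter_joinI:
  assumes "\<And>i. i < n \<Longrightarrow> c i \<in> P"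
  shows "space \<mu> \<inter> (\<Inter>i<n. (T ^^ i) -` c i) \<in> iter_join \<mu> T P n"
  using assms unfolding iter_join_def by blast

text \<open>An itinerary of length m + n is an itinerary of length m followed by one of length n
  read from time m on. The equality is exact because empty intersections are kept as members, so any
  two itineraries may be glued.\<close>

lemma iter_join_add:
  assumes T: "T \<in> measurable \<mu> \<mu>"
  shows "iter_join \<mu> T P (m + n)
    = partition_join (iter_join \<mu> T P m) ((\<lambda>A. (T ^^ m) -` A \<inter> space \<mu>) ` iter_join \<mu> T P n)"
    (is "?L = ?R")
proof (intro set_eqI iffI)
  have Tm: "(T ^^ m) z \<in> space \<mu>" if "z \<in> space \<mu>" for z
    using that by (induction m) (auto intro: measurable_space[OF T])
  have eq: "space \<mu> \<inter> (\<Inter>i<m + n. (T ^^ i) -` c i) = (space \<mu> \<inter> (\<Inter>i<m. (T ^^ i) -` c i))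
      \<inter> ((T ^^ m) -` (space \<mu> \<inter> (\<Inter>i<n. (T ^^ i) -` c (m + i))) \<inter> space \<mu>)" for c :: "nat \<Rightarrow> 'a set"
  proof -
    have "(\<forall>i<m + n. (T ^^ i) z \<in> c i)
        \<longleftrightarrow> (\<forall>i<m. (T ^^ i) z \<in> c i) \<and> (\<forall>i<n. (T ^^ (m + i)) z \<in> c (m + i))" for z
    proof (intro iffI conjI allI impI)
      fix i assume "(\<forall>i<m. (T ^^ i) z \<in> c i) \<and> (\<forall>i<n. (T ^^ (m + i)) z \<in> c (m + i))" "i < m + n"
      then show "(T ^^ i) z \<in> c i" by (cases "i < m") (auto dest: spec[of _ "i - m"])
    qed auto
    moreover have "(T ^^ i) ((T ^^ m) z) = (T ^^ (m + i)) z" for i z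
      by (simp add: funpow_add add.commute[of m])
    ultimately have "z \<in> space \<mu> \<inter> (\<Inter>i<m + n. (T ^^ i) -` c i) \<longleftrightarrow> z \<in> (space \<mu> \<inter> (\<Inter>i<m. (T ^^ i) -` c i))
      \<inter> ((T ^^ m) -` (space \<mu> \<inter> (\<Inter>i<n. (T ^^ i) -` c (m + i))) \<inter> space \<mu>)" for z
      unfolding Int_iff INT_iff vimage_eq Ball_def lessThan_iff using Tm[of z] by metis
    then show ?thesis by blast
  qed
  fix A
  {
    assume "A \<in> ?L"
    then obtain c where c: "\<forall>i<m + n. c i \<in> P" "A = space \<mu> \<inter> (\<Inter>i<m + n. (T ^^ i) -` c i)"
      unfolding iter_join_def by blast
    have "space \<mu> \<inter> (\<Inter>i<m. (T ^^ i) -` c i) \<in> iter_join \<mu> T P m"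
      "space \<mu> \<inter> (\<Inter>i<n. (T ^^ i) -` c (m + i)) \<in> iter_join \<mu> T P n"
      using c(1) iter_joinI[of m c P \<mu> T] iter_joinI[of n "\<lambda>i. c (m + i)" P \<mu> T] by auto
    then show "A \<in> ?R" unfolding c(2) eq partition_join_def by blast
  }
  {
    assume "A \<in> ?R"
    then obtain c d where c: "\<forall>i<m. c i \<in> P" "\<forall>i<n. d i \<in> P"
      and A: "A = (space \<mu> \<inter> (\<Inter>i<m. (T ^^ i) -` c i))
        \<inter> ((T ^^ m) -` (space \<mu> \<inter> (\<Inter>i<n. (T ^^ i) -` d i)) \<inter> space \<mu>)"
      unfolding iter_join_def partition_join_def by blast
    define e where "e i = (if i < m then c i else d (i - m))" for i
    have "A = space \<mu> \<inter> (\<Inter>i<m + n. (T ^^ i) -` e i)"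
      unfolding eq A by (simp add: e_def)
    moreover have "\<forall>i<m + n. e i \<in> P" using c by (auto simp: e_def)
    ultimately show "A \<in> ?L" using iter_joinI[of "m + n" e P \<mu> T] by simp
  }
qed

text \<open>Extensional choice functions form a finite set, so atoms can be counted through their
  names.\<close>

lemma iter_join_eq_image:
  "iter_join \<mu> T P n = (\<lambda>c. space \<mu> \<inter> (\<Inter>i<n. (T ^^ i) -` c i)) ` ({..<n} \<rightarrow>\<^sub>E P)"
proof (intro equalityI subsetI)
  fix A assume "A \<in> iter_join \<mu> T P n"
  then obtain c where c: "\<And>i. i < n \<Longrightarrow> c i \<in> P" "A = space \<mu> \<inter> (\<Inter>i<n. (T ^^ i) -` c i)"
    unfolding iter_join_def by blast
  show "A \<in> (\<lambda>c. space \<mu> \<inter> (\<Inter>i<n. (T ^^ i) -` c i)) ` ({..<n} \<rightarrow>\<^sub>E P)"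
  proof (rule image_eqI)
    show "A = space \<mu> \<inter> (\<Inter>i<n. (T ^^ i) -` restrict c {..<n} i)"
      unfolding c(2) by simp
    show "restrict c {..<n} \<in> {..<n} \<rightarrow>\<^sub>E P" using c(1) by simp
  qed
next
  fix A assume "A \<in> (\<lambda>c. space \<mu> \<inter> (\<Inter>i<n. (T ^^ i) -` c i)) ` ({..<n} \<rightarrow>\<^sub>E P)"
  then obtain c where c: "c \<in> {..<n} \<rightarrow>\<^sub>E P" "A = space \<mu> \<inter> (\<Inter>i<n. (T ^^ i) -` c i)"
    by blast
  show "A \<in> iter_join \<mu> T P n"
    unfolding c(2) by (rule iter_joinI) (use c(1) in auto)
qed

lemma finite_partition_iter_join:
  assumes "finite_partition \<mu> P" "T \<in> measurable \<mu> \<mu>"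
  shows "finite_partition \<mu> (iter_join \<mu> T P n)"
proof (induction n)
  case 0
  then show ?case by (auto simp: iter_join_def finite_partition_def)
next
  case (Suc n)
  have "finite_partition \<mu> (partition_join (iter_join \<mu> T P n) ((\<lambda>A. (T ^^ n) -` A \<inter> space \<mu>) ` iter_join \<mu> T P 1))"
  proof (intro finite_partition_join Suc finite_partition_vimage)
    have "iter_join \<mu> T P 1 = P"
    proof -
      have "space \<mu> \<inter> c = c" if "c \<in> P" for c
        using assms(1) that by (auto simp: finite_partition_def)
      moreover have "iter_join \<mu> T P 1 = (\<lambda>c. space \<mu> \<inter> c) ` P"
      proof -
        have "\<exists>c. A = space \<mu> \<inter> c 0 \<and> c 0 \<in> P" if "A = space \<mu> \<inter> B" "B \<in> P" for A B
          using that by (intro exI[of _ "\<lambda>_. B"]) auto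
        then show ?thesis unfolding iter_join_def by (auto simp: lessThan_Suc)
      qed
      ultimately show ?thesis by simp
    qed
    then show "finite_partition \<mu> (iter_join \<mu> T P 1)" using assms by simp
    show "T ^^ n \<in> measurable \<mu> \<mu>" using assms(2) by (rule measurable_compose_n)
  qed
  then show ?case using iter_join_add[OF assms(2), of P n 1] by simp
qed

text \<open>\<open>entropy_wrt\<close> is a \<open>lim\<close>, which is informative only once
  convergence is known. Invariance makes the entropies of the iterated joins subadditive in n, and
  Fekete's argument applies.\<close>

lemma entropy_wrt_LIMSEQ:
  assumes "prob_space \<mu>" "invariant_measure \<mu> T" "finite_partition \<mu> P"
  shows "(\<lambda>n. partition_entropy \<mu> (iter_join \<mu> T P n) / real n) \<longlonglongrightarrow> entropy_wrt \<mu> T P"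
proof -
  have T: "T \<in> measurable \<mu> \<mu>" using assms(2) by (simp add: invariant_measure_def)
  have "convergent (\<lambda>n. partition_entropy \<mu> (iter_join \<mu> T P n) / real n)"
  proof (rule subadditive_convergent)
    fix m n
    have inv: "T ^^ m \<in> measurable \<mu> \<mu>" "distr \<mu> \<mu> (T ^^ m) = \<mu>"
      using invariant_measure_funpow[OF assms(2), of m] by (auto simp: invariant_measure_def)
    note part = finite_partition_iter_join[OF assms(3) T]
    show "partition_entropy \<mu> (iter_join \<mu> T P (m + n))
        \<le> partition_entropy \<mu> (iter_join \<mu> T P m) + partition_entropy \<mu> (iter_join \<mu> T P n)"
      unfolding iter_join_add[OF T]
      using partition_entropy_join_le[OF assms(1) part finite_partition_vimage[OF part inv(1)], of m n]
        partition_entropy_vimage[OF part inv, of n] by simp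
  qed (rule partition_entropy_nonneg[OF assms(1)])
  then show ?thesis unfolding entropy_wrt_def by (rule convergent_LIMSEQ_iff[THEN iffD1])
qed

section \<open>Counting names in Hamming balls\<close>

text \<open>A Chernoff bound in place of binomial coefficients: give d the weight t to the power of
  its distance from c. Each element of the ball weighs at least t^R, while the total weight of all
  names factors over the coordinates, each factor being at most 1 + |P| t.\<close>

lemma Hamming_ball_card_le:
  fixes t :: real
  assumes "finite P" "c \<in> {..<n} \<rightarrow>\<^sub>E P" "0 < t" "t \<le> 1"
  shows "t ^ R * real (card {d \<in> {..<n} \<rightarrow>\<^sub>E P. card {i. i < n \<and> d i \<noteq> c i} \<le> R})
    \<le> (1 + real (card P) * t) ^ n"
proof -
  define w where "w d = (\<Prod>i<n. if d i = c i then 1 else t)" for d :: "nat \<Rightarrow> 'a"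
  have w_eq: "w d = t ^ card {i. i < n \<and> d i \<noteq> c i}" for d
  proof -
    have "w d = (\<Prod>i\<in>{..<n}. t ^ (if d i \<noteq> c i then 1 else 0))"
      unfolding w_def by (intro prod.cong) auto
    also have "\<dots> = t ^ (\<Sum>i<n. if d i \<noteq> c i then 1 else 0)" by (rule power_sum[symmetric])
    also have "(\<Sum>i<n. if d i \<noteq> c i then 1 else 0) = card {i. i < n \<and> d i \<noteq> c i}"
      by (simp add: sum.If_cases Int_def)
    finally show ?thesis .
  qed
  have fin: "finite ({..<n} \<rightarrow>\<^sub>E P)" using assms(1) by (intro finite_PiE) auto
  let ?H = "{d \<in> {..<n} \<rightarrow>\<^sub>E P. card {i. i < n \<and> d i \<noteq> c i} \<le> R}"
  have "t ^ R * real (card ?H) = (\<Sum>d\<in>?H. t ^ R)" by simp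
  also have "\<dots> \<le> (\<Sum>d\<in>?H. w d)"
  proof (rule sum_mono)
    fix d assume "d \<in> ?H"
    then show "t ^ R \<le> w d" unfolding w_eq using assms(3,4) by (intro power_decreasing) auto
  qed
  also have "\<dots> \<le> (\<Sum>d\<in>{..<n} \<rightarrow>\<^sub>E P. w d)"
    using fin assms by (intro sum_mono2) (auto simp: w_eq)
  also have "\<dots> = (\<Prod>i<n. \<Sum>s\<in>P. if s = c i then 1 else t)"
    unfolding w_def using assms(1) by (subst prod_sum_PiE) auto
  also have "\<dots> \<le> (\<Prod>i<n. 1 + real (card P) * t)"
  proof (intro prod_mono conjI)
    fix i
    show "0 \<le> (\<Sum>s\<in>P. if s = c i then 1 else t)" using assms by (intro sum_nonneg) auto
    have "(\<Sum>s\<in>P. if s = c i then 1 else t) \<le> (\<Sum>s\<in>P. (if s = c i then 1 else 0) + t)"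
      using assms by (intro sum_mono) auto
    also have "\<dots> \<le> 1 + real (card P) * t"
      using assms(1) by (simp add: sum.distrib)
    finally show "(\<Sum>s\<in>P. if s = c i then 1 else t) \<le> 1 + real (card P) * t" .
  qed
  finally show ?thesis by simp
qed

text \<open>The names in one fibre of the code lie in a Hamming ball around any one of them, so the
  number of codes times the bound for a ball suffices. Centres may be chosen freely in each fibre,
  since the ball bound does not depend on the centre.\<close>

lemma card_names_le:
  fixes t :: real and name :: "'z \<Rightarrow> nat \<Rightarrow> 'b"
  assumes "finite P" "\<And>z. z \<in> Y \<Longrightarrow> name z \<in> {..<n} \<rightarrow>\<^sub>E P" "0 < t" "t \<le> 1"
    and "finite I" "\<And>z. z \<in> Y \<Longrightarrow> code z \<in> I"
    and "\<And>z z'. z \<in> Y \<Longrightarrow> z' \<in> Y \<Longrightarrow> code z = code z' \<Longrightarrow> card {i. i < n \<and> name z' i \<noteq> name z i} \<le> R"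
  shows "t ^ R * real (card (name ` Y)) \<le> real (card I) * (1 + real (card P) * t) ^ n"
proof -
  define Z where "Z v = {z \<in> Y. code z = v}" for v
  have fin: "finite ({..<n} \<rightarrow>\<^sub>E P)" using assms(1) by (intro finite_PiE) auto
  have Zle: "t ^ R * real (card (name ` Z v)) \<le> (1 + real (card P) * t) ^ n" for v
  proof (cases "Z v = {}")
    case True
    then show ?thesis using assms by simp
  next
    case False
    then obtain z where z: "z \<in> Y" "code z = v" by (auto simp: Z_def)
    have "name ` Z v \<subseteq> {d \<in> {..<n} \<rightarrow>\<^sub>E P. card {i. i < n \<and> d i \<noteq> name z i} \<le> R}"
      using assms(2,7) z by (auto simp: Z_def)
    then have "card (name ` Z v) \<le> card {d \<in> {..<n} \<rightarrow>\<^sub>E P. card {i. i < n \<and> d i \<noteq> name z i} \<le> R}"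
      using fin by (intro card_mono) auto
    then have "t ^ R * real (card (name ` Z v))
        \<le> t ^ R * real (card {d \<in> {..<n} \<rightarrow>\<^sub>E P. card {i. i < n \<and> d i \<noteq> name z i} \<le> R})"
      using assms by (intro mult_left_mono) auto
    also have "\<dots> \<le> (1 + real (card P) * t) ^ n"
      using assms z by (intro Hamming_ball_card_le) auto
    finally show ?thesis .
  qed
  have "name ` Y = (\<Union>v\<in>I. name ` Z v)" using assms(6) by (auto simp: Z_def)
  then have "card (name ` Y) \<le> (\<Sum>v\<in>I. card (name ` Z v))"
    using card_UN_le[OF assms(5)] by simp
  then have "t ^ R * real (card (name ` Y)) \<le> t ^ R * (\<Sum>v\<in>I. real (card (name ` Z v)))"
    using assms(3) by (intro mult_left_mono) (auto simp: of_nat_sum[symmetric] simp del: of_nat_sum)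
  also have "\<dots> = (\<Sum>v\<in>I. t ^ R * real (card (name ` Z v)))" by (rule sum_distrib_left)
  also have "\<dots> \<le> (\<Sum>v\<in>I. (1 + real (card P) * t) ^ n)" by (intro sum_mono Zle)
  finally show ?thesis by simp
qed

section \<open>Regularity of measures\<close>

text \<open>The sets of points whose ball of radius r stays in S increase to S as r decreases to 0.
  The radius is kept in the statement because it later serves as the scale on which membership in S
  is decided.\<close>

lemma open_inner_approx:
  fixes S :: "'a::metric_space set"
  assumes "finite_measure M" "sets M = sets borel" "open S" "0 < \<eta>"
  shows "\<exists>r>0. closed {x. ball x r \<subseteq> S} \<and> measure M (S - {x. ball x r \<subseteq> S}) < \<eta>"
proof -
  interpret finite_measure M by fact
  define C where "C r = {x. ball x r \<subseteq> S}" for r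
  have cl: "closed (C r)" for r
  proof -
    have "ball x r \<subseteq> S \<longleftrightarrow> (\<forall>y\<in>- S. r \<le> dist x y)" for x
      by (auto simp: subset_eq not_le[symmetric])
    then have "C r = (\<Inter>y\<in>-S. {x. r \<le> dist x y})" by (simp add: C_def set_eq_iff)
    then show ?thesis by (auto intro!: closed_INT closed_Collect_le continuous_intros)
  qed
  define D where "D n = S - C (inverse (real (Suc n)))" for n
  have "(\<lambda>n. measure M (D n)) \<longlonglongrightarrow> measure M (\<Inter>n. D n)"
  proof (rule finite_Lim_measure_decseq)
    show "range D \<subseteq> sets M" using cl assms by (auto simp: D_def)
    show "decseq D"
    proof (rule decseq_SucI)
      fix n
      have "inverse (real (Suc (Suc n))) \<le> inverse (real (Suc n))" by (intro le_imp_inverse_le) auto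
      then show "D (Suc n) \<subseteq> D n"
        unfolding D_def C_def using subset_ball by blast
    qed
  qed
  moreover have "(\<Inter>n. D n) = {}"
  proof (rule ccontr)
    assume "(\<Inter>n. D n) \<noteq> {}"
    then obtain x where x: "\<And>n. x \<in> D n" by auto
    then have "x \<in> S" by (auto simp: D_def)
    then obtain e where e: "e > 0" "ball x e \<subseteq> S" using assms(3) open_contains_ball by blast
    obtain n where "inverse (real (Suc n)) < e" using reals_Archimedean e(1) by blast
    then have "x \<in> C (inverse (real (Suc n)))"
      unfolding C_def using e subset_ball[of "inverse (real (Suc n))" e x] by auto
    then show False using x[of n] by (simp add: D_def)
  qed
  ultimately have "(\<lambda>n. measure M (D n)) \<longlonglongrightarrow> 0" by simp
  then have "\<forall>\<^sub>F n in sequentially. measure M (D n) < \<eta>"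
    using assms(4) by (rule order_tendstoD(2))
  then obtain n where "measure M (D n) < \<eta>" by (auto simp: eventually_sequentially)
  then show ?thesis using cl[of "inverse (real (Suc n))"]
    unfolding D_def C_def by (intro exI[of _ "inverse (real (Suc n))"]) auto
qed

text \<open>Closed approximation from inside and open approximation from outside are proved
  together, because complements exchange them. For a countable union all the open sets can be kept,
  but only finitely many closed ones.\<close>

lemma borel_closed_open_approx:
  fixes A :: "'a::metric_space set"
  assumes "finite_measure M" and sets: "sets M = sets borel" and "A \<in> sets borel" "0 < \<eta>"
  shows "\<exists>C U. closed C \<and> open U \<and> C \<subseteq> A \<and> A \<subseteq> U \<and> measure M (U - C) < \<eta>"
proof -
  interpret finite_measure M by fact
  have "A \<in> sigma_sets UNIV {S. open S}" using assms(3) by (simp add: borel_def)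
  then show ?thesis using assms(4)
  proof (induction arbitrary: \<eta> rule: sigma_sets.induct)
    case (Basic S)
    then obtain r where "closed {x. ball x r \<subseteq> S}" "measure M (S - {x. ball x r \<subseteq> S}) < \<eta>" "r > 0"
      using open_inner_approx[OF assms(1,2), of S \<eta>] by auto
    moreover have "{x. ball x r \<subseteq> S} \<subseteq> S" using \<open>r > 0\<close> by auto
    ultimately show ?case using Basic by blast
  next
    case Empty
    then show ?case by (intro exI[of _ "{}"]) auto
  next
    case (Compl A)
    from Compl.IH[OF Compl.prems] obtain C U where "closed C" "open U" "C \<subseteq> A" "A \<subseteq> U" "measure M (U - C) < \<eta>"
      by blast
    moreover have "- C - - U = U - C" by auto
    ultimately show ?case
      by (intro exI[of _ "- U"] exI[of _ "- C"]) (auto simp: open_Compl closed_Compl)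
  next
    case (Union A)
    \<comment> \<open>The tolerances add up to \<eta>/2; the other half is reserved for cutting off
      the union of the closed sets.\<close>
    have "\<forall>i. \<exists>C U. closed C \<and> open U \<and> C \<subseteq> A i \<and> A i \<subseteq> U \<and> measure M (U - C) < \<eta> / 2 * (1/2) ^ Suc i"
      using Union by (intro allI Union.IH) auto
    then obtain C U where CU: "\<And>i. closed (C i)" "\<And>i. open (U i)" "\<And>i. C i \<subseteq> A i" "\<And>i. A i \<subseteq> U i"
      "\<And>i. measure M (U i - C i) < \<eta> / 2 * (1/2) ^ Suc i" by metis
    have CUs: "C i \<in> sets M" "U i \<in> sets M" for i using CU sets by auto
    have sums: "(\<lambda>i. \<eta> / 2 * (1/2) ^ Suc i) sums (\<eta> / 2 * 1)"
      by (intro sums_mult power_half_series)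
    have summ: "summable (\<lambda>i. measure M (U i - C i))"
      by (rule summable_comparison_test'[OF sums_summable[OF sums], of 0])
        (use CU(5) in \<open>auto intro: less_imp_le\<close>)
    have "measure M (\<Union>i. U i - C i) \<le> (\<Sum>i. measure M (U i - C i))"
      by (rule finite_measure_subadditive_countably) (use CUs summ in auto)
    also have "\<dots> \<le> \<eta> / 2"
      using suminf_le[OF less_imp_le[OF CU(5)] summ sums_summable[OF sums]] sums_unique[OF sums] by simp
    finally have m1: "measure M (\<Union>i. U i - C i) \<le> \<eta> / 2" .
    define D where "D n = (\<Union>i. C i) - (\<Union>i<n. C i)" for n
    have "(\<lambda>n. measure M (D n)) \<longlonglongrightarrow> measure M (\<Inter>n. D n)"
    proof (rule finite_Lim_measure_decseq)
      show "range D \<subseteq> sets M" using CUs by (auto simp: D_def)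
      show "decseq D" by (rule decseq_SucI) (auto simp: D_def less_Suc_eq)
    qed
    moreover have "(\<Inter>n. D n) = {}" by (auto simp: D_def)
    ultimately have "(\<lambda>n. measure M (D n)) \<longlonglongrightarrow> 0" by simp
    then have "\<forall>\<^sub>F n in sequentially. measure M (D n) < \<eta> / 2"
      using Union.prems by (intro order_tendstoD(2)) auto
    then obtain n where n: "measure M (D n) < \<eta> / 2" by (auto simp: eventually_sequentially)
    have Ds: "D n \<in> sets M" using CUs by (auto simp: D_def)
    have "measure M ((\<Union>i. U i) - (\<Union>i<n. C i)) \<le> measure M ((\<Union>i. U i - C i) \<union> D n)"
      using CUs Ds by (intro finite_measure_mono) (auto simp: D_def)
    also have "\<dots> \<le> measure M (\<Union>i. U i - C i) + measure M (D n)"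
      using CUs Ds by (intro measure_Un_le) auto
    also have "\<dots> < \<eta>" using m1 n by linarith
    finally have "measure M ((\<Union>i. U i) - (\<Union>i<n. C i)) < \<eta>" .
    moreover have "closed (\<Union>i<n. C i)" "open (\<Union>i. U i)" using CU by auto
    moreover have "(\<Union>i<n. C i) \<subseteq> (\<Union>i. A i)" "(\<Union>i. A i) \<subseteq> (\<Union>i. U i)" using CU(3,4) by blast+
    ultimately show ?case by blast
  qed
qed

section \<open>A Lusin property for sets in the skew product\<close>

definition cylinder_constant_on ::
    "((nat \<Rightarrow> nat) \<times> 'a::metric_space) set \<Rightarrow> nat \<Rightarrow> real \<Rightarrow> ((nat \<Rightarrow> nat) \<times> 'a) set set \<Rightarrow> bool" where
  "cylinder_constant_on B m \<epsilon> \<A> \<longleftrightarrow> (\<forall>z\<in>B. \<forall>z'\<in>B. (\<forall>i<m. fst z i = fst z' i) \<longrightarrow>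
     dist (snd z) (snd z') \<le> \<epsilon> \<longrightarrow> (\<forall>A\<in>\<A>. z \<in> A \<longleftrightarrow> z' \<in> A))"

text \<open>A Lusin property: off a set of small measure, membership in the sets of the family is decided
  by finitely many symbols and an approximate position in X.\<close>

definition approximable :: "((nat \<Rightarrow> nat) \<times> 'a::metric_space) measure \<Rightarrow> ((nat \<Rightarrow> nat) \<times> 'a) set set \<Rightarrow> bool" where
  "approximable \<mu> \<A> \<longleftrightarrow> (\<forall>\<eta>>0. \<exists>B\<in>sets \<mu>. \<exists>m. \<exists>\<epsilon>>0.
     measure \<mu> (space \<mu> - B) < \<eta> \<and> cylinder_constant_on B m \<epsilon> \<A>)"

lemma cylinder_constant_onI:
  assumes "\<And>z z' A. z \<in> B \<Longrightarrow> z' \<in> B \<Longrightarrow> \<forall>i<m. fst z i = fst z' i \<Longrightarrow> dist (snd z) (snd z') \<le> \<epsilon> \<Longrightarrow>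
    A \<in> \<A> \<Longrightarrow> z \<in> A \<longleftrightarrow> z' \<in> A"
  shows "cylinder_constant_on B m \<epsilon> \<A>"
  using assms unfolding cylinder_constant_on_def by blast

lemma cylinder_constant_onD:
  assumes "cylinder_constant_on B m \<epsilon> \<A>" "z \<in> B" "z' \<in> B" "\<forall>i<m. fst z i = fst z' i"
    "dist (snd z) (snd z') \<le> \<epsilon>" "A \<in> \<A>"
  shows "z \<in> A \<longleftrightarrow> z' \<in> A"
  using assms unfolding cylinder_constant_on_def by blast

text \<open>Good sets are intersected, m is the maximum and \<epsilon> the minimum. This provides a
  single good set for all atoms of a partition, and for the finite part of a countable
  union.\<close>

lemma approximable_finite:
  assumes "finite_measure \<mu>" "finite \<A>" "\<And>A. A \<in> \<A> \<Longrightarrow> approximable \<mu> {A}"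
  shows "approximable \<mu> \<A>"
  using assms(2,3)
proof (induction \<A> rule: finite_induct)
  case empty
  interpret finite_measure \<mu> by fact
  show ?case unfolding approximable_def cylinder_constant_on_def
    by (intro allI impI bexI[of _ "space \<mu>"] exI[of _ 1]) auto
next
  case (insert A \<A>)
  interpret finite_measure \<mu> by fact
  show ?case unfolding approximable_def
  proof (intro allI impI)
    fix \<eta> :: real assume "\<eta> > 0"
    then have h: "\<eta> / 2 > 0" by simp
    have a: "approximable \<mu> {A}" "approximable \<mu> \<A>" using insert by simp_all
    obtain B m \<epsilon> where 1: "B \<in> sets \<mu>" "0 < \<epsilon>" "measure \<mu> (space \<mu> - B) < \<eta> / 2" "cylinder_constant_on B m \<epsilon> {A}"
      using a(1) h unfolding approximable_def by blast
    obtain B' m' \<epsilon>' where 2: "B' \<in> sets \<mu>" "0 < \<epsilon>'" "measure \<mu> (space \<mu> - B') < \<eta> / 2" "cylinder_constant_on B' m' \<epsilon>' \<A>"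
      using a(2) h unfolding approximable_def by blast
    have "measure \<mu> (space \<mu> - B \<inter> B') \<le> measure \<mu> ((space \<mu> - B) \<union> (space \<mu> - B'))"
      using 1 2 by (intro finite_measure_mono) auto
    also have "\<dots> \<le> measure \<mu> (space \<mu> - B) + measure \<mu> (space \<mu> - B')"
      using 1 2 by (intro measure_Un_le) auto
    also have "\<dots> < \<eta>" using 1 2 by simp
    finally have "measure \<mu> (space \<mu> - B \<inter> B') < \<eta>" .
    then show "\<exists>B\<in>sets \<mu>. \<exists>m. \<exists>\<epsilon>>0. measure \<mu> (space \<mu> - B) < \<eta> \<and> cylinder_constant_on B m \<epsilon> (insert A \<A>)"
    proof (intro bexI[of _ "B \<inter> B'"] exI[of _ "max m m'"] exI[of _ "min \<epsilon> \<epsilon>'"] conjI)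
      show "cylinder_constant_on (B \<inter> B') (max m m') (min \<epsilon> \<epsilon>') (insert A \<A>)"
      proof (rule cylinder_constant_onI)
        fix z z' C assume *: "z \<in> B \<inter> B'" "z' \<in> B \<inter> B'" "\<forall>i<max m m'. fst z i = fst z' i"
          "dist (snd z) (snd z') \<le> min \<epsilon> \<epsilon>'" "C \<in> insert A \<A>"
        have eq: "\<forall>i<m. fst z i = fst z' i" "\<forall>i<m'. fst z i = fst z' i"
          using *(3) by (meson less_max_iff_disj)+
        have d: "dist (snd z) (snd z') \<le> \<epsilon>" "dist (snd z) (snd z') \<le> \<epsilon>'" using *(4) by auto
        from *(5) show "z \<in> C \<longleftrightarrow> z' \<in> C"
        proof (rule insertE)
          assume "C = A"
          then show ?thesis using cylinder_constant_onD[OF 1(4) _ _ eq(1) d(1)] * by blast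
        next
          assume "C \<in> \<A>"
          then show ?thesis using cylinder_constant_onD[OF 2(4) _ _ eq(2) d(2)] * by blast
        qed
      qed
    qed (use 1 2 in auto)
  qed
qed

text \<open>The approximable measurable sets form a \<sigma>-algebra. It contains the cylinders,
  with the whole space as good set, and the preimages of open subsets of the fibre, so both
  projections stay measurable for it. By the universal property of the product it contains every set
  of \<open>\<mu>\<close>.\<close>

lemma approximable_skew_space:
  fixes X :: "'a::metric_space set"
  assumes "finite_measure \<mu>" and sets: "sets \<mu> = sets (skew_space p X)" and "A \<in> sets \<mu>"
  shows "approximable \<mu> {A}"
proof -
  interpret finite_measure \<mu> by fact
  have sp: "space \<mu> = space (skew_space p X)" by (rule sets_eq_imp_space_eq[OF sets])
  have fst_meas: "fst \<in> measurable \<mu> (shift_space p)"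
    unfolding measurable_cong_sets[OF sets refl] skew_space_def by simp
  have fst_i: "(\<lambda>z. fst z i) \<in> measurable \<mu> (count_space {..<p})" for i
    using measurable_compose[OF fst_meas, of "\<lambda>w. w i"] unfolding shift_space_def
    by (simp add: measurable_component_singleton)
  have snd_res: "snd \<in> measurable \<mu> (restrict_space borel X)"
    unfolding measurable_cong_sets[OF sets refl] skew_space_def by simp
  then have snd_meas: "snd \<in> measurable \<mu> borel"
    by (simp add: measurable_restrict_space2_iff)
  define G where "G = {A \<in> sets \<mu>. approximable \<mu> {A}}"
  have sigma: "sigma_algebra (space \<mu>) G"
    unfolding sigma_algebra_iff2
  proof (intro conjI allI impI ballI)
    show "G \<subseteq> Pow (space \<mu>)" using sets.sets_into_space by (auto simp: G_def)
    have "approximable \<mu> {{}}" unfolding approximable_def cylinder_constant_on_def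
      by (intro allI impI bexI[of _ "space \<mu>"] exI[of _ 1]) auto
    then show "{} \<in> G" by (simp add: G_def)
  next
    fix A assume A: "A \<in> G"
    have "approximable \<mu> {space \<mu> - A}"
      unfolding approximable_def
    proof (intro allI impI)
      fix \<eta> :: real assume "\<eta> > 0"
      have "approximable \<mu> {A}" using A by (simp add: G_def)
      from this \<open>\<eta> > 0\<close> obtain B m \<epsilon> where 1: "B \<in> sets \<mu>" "0 < \<epsilon>" "measure \<mu> (space \<mu> - B) < \<eta>" "cylinder_constant_on B m \<epsilon> {A}"
        unfolding approximable_def by blast
      have "z \<in> space \<mu>" if "z \<in> B" for z using that 1(1) sets.sets_into_space by blast
      with 1 show "\<exists>B\<in>sets \<mu>. \<exists>m. \<exists>\<epsilon>>0. measure \<mu> (space \<mu> - B) < \<eta> \<and> cylinder_constant_on B m \<epsilon> {space \<mu> - A}"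
        unfolding cylinder_constant_on_def by (intro bexI[of _ B] exI[of _ m] exI[of _ \<epsilon>]) blast+
    qed
    then show "space \<mu> - A \<in> G" using A by (auto simp: G_def)
  next
    fix A :: "nat \<Rightarrow> ((nat \<Rightarrow> nat) \<times> 'a) set" assume A: "range A \<subseteq> G"
    then have As: "A i \<in> sets \<mu>" and Aa: "approximable \<mu> {A i}" for i by (auto simp: G_def)
    \<comment> \<open>The first n members decide the union except on the tail \<open>D n\<close>,
      which has small measure for large n and is removed from the good set.\<close>
    define D where "D n = (\<Union>i. A i) - (\<Union>i<n. A i)" for n
    have Ds: "D n \<in> sets \<mu>" for n using As by (auto simp: D_def)
    have "(\<lambda>n. measure \<mu> (D n)) \<longlonglongrightarrow> measure \<mu> (\<Inter>n. D n)"
    proof (rule finite_Lim_measure_decseq)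
      show "range D \<subseteq> sets \<mu>" using Ds by auto
      show "decseq D" by (rule decseq_SucI) (auto simp: D_def less_Suc_eq)
    qed
    moreover have "(\<Inter>n. D n) = {}" by (auto simp: D_def)
    ultimately have lim: "(\<lambda>n. measure \<mu> (D n)) \<longlonglongrightarrow> 0" by simp
    have "approximable \<mu> {\<Union>i. A i}"
      unfolding approximable_def
    proof (intro allI impI)
      fix \<eta> :: real assume "\<eta> > 0"
      then have h: "\<eta> / 2 > 0" by simp
      from order_tendstoD(2)[OF lim h] obtain n where n: "measure \<mu> (D n) < \<eta> / 2"
        by (auto simp: eventually_sequentially)
      have "approximable \<mu> (A ` {..<n})"
        by (rule approximable_finite[OF assms(1)]) (use Aa in auto)
      from this h obtain B m \<epsilon> where 1: "B \<in> sets \<mu>" "0 < \<epsilon>" "measure \<mu> (space \<mu> - B) < \<eta> / 2" "cylinder_constant_on B m \<epsilon> (A ` {..<n})"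
        unfolding approximable_def by blast
      have "measure \<mu> (space \<mu> - (B - D n)) \<le> measure \<mu> ((space \<mu> - B) \<union> D n)"
        using 1 Ds by (intro finite_measure_mono) auto
      also have "\<dots> \<le> measure \<mu> (space \<mu> - B) + measure \<mu> (D n)"
        using 1 Ds by (intro measure_Un_le) auto
      also have "\<dots> < \<eta>" using 1 n by simp
      finally have m: "measure \<mu> (space \<mu> - (B - D n)) < \<eta>" .
      have eq: "z \<in> (\<Union>i. A i) \<longleftrightarrow> (\<exists>i<n. z \<in> A i)" if "z \<in> B - D n" for z
        using that by (auto simp: D_def)
      have "z \<in> (\<Union>i. A i) \<longleftrightarrow> z' \<in> (\<Union>i. A i)"
        if "z \<in> B - D n" "z' \<in> B - D n" "\<forall>i<m. fst z i = fst z' i" "dist (snd z) (snd z') \<le> \<epsilon>" for z z'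
        unfolding eq[OF that(1)] eq[OF that(2)]
        using cylinder_constant_onD[OF 1(4) _ _ that(3,4)] that(1,2) by blast
      then have "cylinder_constant_on (B - D n) m \<epsilon> {\<Union>i. A i}"
        by (intro cylinder_constant_onI) blast
      with m show "\<exists>B\<in>sets \<mu>. \<exists>m. \<exists>\<epsilon>>0. measure \<mu> (space \<mu> - B) < \<eta> \<and> cylinder_constant_on B m \<epsilon> {\<Union>i. A i}"
        using 1(1,2) Ds by (intro bexI[of _ "B - D n"] exI[of _ m] exI[of _ \<epsilon>]) blast+
    qed
    then show "(\<Union>i. A i) \<in> G" using As by (auto simp: G_def)
  qed
  \<comment> \<open>The same space with the approximable sets as its \<sigma>-algebra: that a set is
    approximable can now be derived from measurability theorems for \<open>N\<close>.\<close>
  define N where "N = sigma (space \<mu>) G"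
  have spN: "space N = space \<mu>" using sigma sigma_algebra_iff2[of "space \<mu>" G]
    unfolding N_def by (intro space_measure_of) auto
  have setsN: "sets N = G" unfolding N_def by (rule sigma_algebra.sets_measure_of_eq[OF sigma])
  have spc: "fst z i < p" "snd z \<in> X" if "z \<in> space \<mu>" for z i
    using that unfolding sp skew_space_def shift_space_def
    by (auto simp: space_pair_measure space_PiM space_restrict_space)
  have "(\<lambda>z i. fst z i) \<in> measurable N (shift_space p)"
    unfolding shift_space_def
  proof (rule measurable_PiM_single')
    fix i :: nat
    have "(\<lambda>z. fst z i) -` {a} \<inter> space N \<in> G" if "a < p" for a
    proof -
      have "(\<lambda>z. fst z i) -` {a} \<inter> space \<mu> \<in> sets \<mu>"
        by (rule measurable_sets[OF fst_i]) (use that in auto)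
      moreover have "approximable \<mu> {(\<lambda>z. fst z i) -` {a} \<inter> space \<mu>}"
        unfolding approximable_def
        by (intro allI impI bexI[of _ "space \<mu>"] exI[of _ "Suc i"] exI[of _ 1])
          (auto simp: cylinder_constant_on_def)
      ultimately show ?thesis by (simp add: G_def spN)
    qed
    then show "(\<lambda>z. fst z i) \<in> measurable N (count_space {..<p})"
      by (auto simp: measurable_count_space_eq2 setsN spN spc)
  next
    show "(\<lambda>z i. fst z i) \<in> space N \<rightarrow> (\<Pi>\<^sub>E i\<in>UNIV. space (count_space {..<p}))"
      by (intro Pi_I) (simp add: spN spc(1) PiE_UNIV_domain Pi_iff)
  qed
  then have "fst \<in> measurable N (shift_space p)" by simp
  moreover have "snd \<in> measurable N (restrict_space borel X)"
  proof (rule measurable_restrict_space2)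
    show "snd \<in> space N \<rightarrow> X" by (auto simp: spN spc)
    show "snd \<in> borel_measurable N"
    proof (rule borel_measurableI)
      fix S :: "'a set" assume "open S"
      have "approximable \<mu> {snd -` S \<inter> space \<mu>}"
        unfolding approximable_def
      proof (intro allI impI)
        fix \<eta> :: real assume "\<eta> > 0"
        have "finite_measure (distr \<mu> borel snd)" by (rule finite_measure_distr[OF snd_meas])
        from open_inner_approx[OF this _ \<open>open S\<close> \<open>\<eta> > 0\<close>] obtain r where
          r: "r > 0" "closed {x. ball x r \<subseteq> S}" "measure (distr \<mu> borel snd) (S - {x. ball x r \<subseteq> S}) < \<eta>"
          by auto
        \<comment> \<open>The layer of S where the ball of radius r leaves S is cut out. A remaining
          point of S then has all points within r/2 in S; halving r reconciles the non-strict
          distance bound with the open ball.\<close>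
        define B where "B = space \<mu> - snd -` (S - {x. ball x r \<subseteq> S})"
        have sC: "S - {x. ball x r \<subseteq> S} \<in> sets borel" using r(2) \<open>open S\<close> by auto
        have "snd -` (S - {x. ball x r \<subseteq> S}) \<inter> space \<mu> \<in> sets \<mu>"
          by (rule measurable_sets[OF snd_meas sC])
        moreover have Beq: "B = space \<mu> - (snd -` (S - {x. ball x r \<subseteq> S}) \<inter> space \<mu>)"
          by (auto simp: B_def)
        ultimately have B: "B \<in> sets \<mu>" by (metis sets.compl_sets)
        have "space \<mu> - B = snd -` (S - {x. ball x r \<subseteq> S}) \<inter> space \<mu>" by (auto simp: B_def)
        then have "measure \<mu> (space \<mu> - B) < \<eta>" using r(3) by (simp add: measure_distr[OF snd_meas sC])
        moreover have in_S: "snd z' \<in> S" if "z \<in> B" "dist (snd z) (snd z') \<le> r / 2" "snd z \<in> S" for z z'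
        proof -
          have "ball (snd z) r \<subseteq> S" using that by (auto simp: B_def)
          moreover have "snd z' \<in> ball (snd z) r" using that(2) r(1) by (simp add: mem_ball)
          ultimately show ?thesis by blast
        qed
        have "cylinder_constant_on B 0 (r / 2) {snd -` S \<inter> space \<mu>}"
        proof (rule cylinder_constant_onI)
          fix z z' A assume *: "z \<in> B" "z' \<in> B" "dist (snd z) (snd z') \<le> r / 2" "A \<in> {snd -` S \<inter> space \<mu>}"
          have "z \<in> space \<mu>" "z' \<in> space \<mu>" using *(1,2) by (simp_all add: B_def)
          moreover have "snd z \<in> S \<longleftrightarrow> snd z' \<in> S"
            using in_S[OF *(1,3)] in_S[OF *(2), of z] *(3) by (auto simp: dist_commute)
          ultimately show "z \<in> A \<longleftrightarrow> z' \<in> A" using *(4) by simp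
        qed
        ultimately show "\<exists>B\<in>sets \<mu>. \<exists>m. \<exists>\<epsilon>>0. measure \<mu> (space \<mu> - B) < \<eta> \<and> cylinder_constant_on B m \<epsilon> {snd -` S \<inter> space \<mu>}"
          using B r(1) half_gt_zero by blast
      qed
      moreover have "snd -` S \<inter> space \<mu> \<in> sets \<mu>"
        using \<open>open S\<close> by (intro measurable_sets[OF snd_meas]) auto
      ultimately show "snd -` S \<inter> space N \<in> sets N" by (simp add: setsN spN G_def)
    qed
  qed
  ultimately have "(\<lambda>z. (fst z, snd z)) \<in> measurable N (skew_space p X)"
    unfolding skew_space_def by (rule measurable_Pair)
  \<comment> \<open>Measurability of the identity from \<open>N\<close> to \<mu> says that every
    measurable set belongs to \<open>G\<close>.\<close>
  then have "(\<lambda>z. z) \<in> measurable N \<mu>" unfolding measurable_cong_sets[OF refl sets] by simp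
  from measurable_sets[OF this assms(3)] have "A \<in> G"
    using sets.sets_into_space[OF assms(3)] by (simp add: setsN spN Int_absorb2)
  then show ?thesis by (simp add: G_def)
qed

section \<open>Separated sets\<close>

lemma dword_le_iff:
  "dword g ws x y \<le> \<epsilon> \<longleftrightarrow> (\<forall>j\<le>length ws. dist (orbit_pt g ws j x) (orbit_pt g ws j y) \<le> \<epsilon>)"
proof -
  have "{dist (orbit_pt g ws j x) (orbit_pt g ws j y) | j. j \<le> length ws}
      = (\<lambda>j. dist (orbit_pt g ws j x) (orbit_pt g ws j y)) ` {..length ws}" by auto
  then show ?thesis unfolding dword_def by auto
qed

text \<open>This time shift lets separated sets in K control points outside K: the distances along w
  between two image points under v are among those that \<open>dword\<close> maximizes for
  \<open>v @ w\<close>.\<close>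

lemma orbit_pt_append:
  "orbit_pt g (v @ w) (length v + j) x = orbit_pt g w j (orbit_pt g v (length v) x)"
  by (simp add: orbit_pt_def)

text \<open>The length n is free above i, so that one finite word describes the fibre coordinate at
  all times up to n.\<close>

lemma skew_map_funpow:
  assumes "i \<le> n"
  shows "(skew_map g ^^ i) (\<omega>, x) = (\<lambda>k. \<omega> (k + i), orbit_pt g (map \<omega> [0..<n]) i x)"
  using assms
proof (induction i)
  case (Suc i)
  have "take (Suc i) (map \<omega> [0..<n]) = take i (map \<omega> [0..<n]) @ [\<omega> i]"
    using Suc.prems by (simp add: take_Suc_conv_app_nth)
  then show ?case using Suc by (simp add: skew_map_def shift_def orbit_pt_def)
qed (simp add: orbit_pt_def)

definition separated_on :: "(nat \<Rightarrow> 'a::metric_space \<Rightarrow> 'a) \<Rightarrow> 'a set \<Rightarrow> nat list \<Rightarrow> real \<Rightarrow> 'a set \<Rightarrow> bool" where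
  "separated_on g K ws \<epsilon> E \<longleftrightarrow> E \<subseteq> K \<and> finite E \<and> (\<forall>x\<in>E. \<forall>y\<in>E. x \<noteq> y \<longrightarrow> dword g ws x y > \<epsilon>)"

lemma sep_card_eq: "sep_card g K ws \<epsilon> = Sup (card ` Collect (separated_on g K ws \<epsilon>))"
  unfolding sep_card_def separated_on_def by (rule arg_cong[of _ _ Sup]) auto

locale semigroup_action =
  fixes X :: "'a::metric_space set" and p :: nat and g :: "nat \<Rightarrow> 'a \<Rightarrow> 'a"
  assumes compact: "compact X"
    and p_pos: "p \<ge> 1"
    and cont: "\<And>i. i < p \<Longrightarrow> continuous_on X (g i)"
    and maps: "\<And>i. i < p \<Longrightarrow> g i ` X \<subseteq> X"
begin

lemma orbit_pt_in:
  assumes "x \<in> X" "set ws \<subseteq> {..<p}"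
  shows "orbit_pt g ws j x \<in> X"
proof -
  have "foldl (\<lambda>y i. g i y) x vs \<in> X" if "set vs \<subseteq> {..<p}" for vs
    using that assms(1)
  proof (induction vs arbitrary: x)
    case (Cons i vs)
    then show ?case using maps[of i] by (auto intro!: Cons.IH)
  qed simp
  moreover have "set (take j ws) \<subseteq> {..<p}" using assms(2) set_take_subset by fast
  ultimately show ?thesis by (simp add: orbit_pt_def)
qed

lemma continuous_on_orbit_pt:
  assumes "set ws \<subseteq> {..<p}"
  shows "continuous_on X (orbit_pt g ws j)"
proof -
  have "continuous_on X (\<lambda>x. foldl (\<lambda>y i. g i y) x vs)" if "set vs \<subseteq> {..<p}" for vs
    using that
  proof (induction vs)
    case (Cons i vs)
    have "continuous_on (g i ` X) (\<lambda>x. foldl (\<lambda>y i. g i y) x vs)"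
      using Cons maps[of i] by (auto intro: continuous_on_subset)
    from continuous_on_compose[OF cont this] Cons.prems show ?case by (simp add: comp_def)
  qed simp
  moreover have "set (take j ws) \<subseteq> {..<p}" using assms set_take_subset by fast
  ultimately show ?thesis by (simp add: orbit_pt_def[abs_def])
qed

text \<open>Points are coded by the balls of a finite cover which their orbits visit; two points with the
  same code are not separated.\<close>

lemma separated_on_card_bounded:
  assumes "set ws \<subseteq> {..<p}" "K \<subseteq> X" "0 < \<epsilon>"
  shows "\<exists>N. \<forall>E. separated_on g K ws \<epsilon> E \<longrightarrow> card E \<le> N"
proof -
  have "\<exists>k. finite k \<and> X \<subseteq> (\<Union>x\<in>k. ball x (\<epsilon> / 2))"
    using compact assms(3) unfolding compact_eq_totally_bounded by simp
  then obtain C where C: "finite C" "X \<subseteq> (\<Union>x\<in>C. ball x (\<epsilon> / 2))" by blast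
  define f where "f y = (SOME c. c \<in> C \<and> dist c y < \<epsilon> / 2)" for y
  have f: "f y \<in> C \<and> dist (f y) y < \<epsilon> / 2" if "y \<in> X" for y
  proof -
    have "\<exists>c\<in>C. y \<in> ball c (\<epsilon> / 2)" using that C(2) by blast
    then show ?thesis unfolding f_def mem_ball by (intro someI_ex[of "\<lambda>c. c \<in> C \<and> dist c y < \<epsilon> / 2"]) blast
  qed
  define code where "code y = restrict (\<lambda>j. f (orbit_pt g ws j y)) {..length ws}" for y
  have code: "code y \<in> {..length ws} \<rightarrow>\<^sub>E C" if "y \<in> X" for y
    using that f orbit_pt_in[OF _ assms(1)] by (auto simp: code_def)
  have fin: "finite ({..length ws} \<rightarrow>\<^sub>E C)" using C by (intro finite_PiE) auto
  show ?thesis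
  proof (intro exI allI impI)
    fix E assume "separated_on g K ws \<epsilon> E"
    then have E: "E \<subseteq> X" "\<And>x y. x \<in> E \<Longrightarrow> y \<in> E \<Longrightarrow> x \<noteq> y \<Longrightarrow> dword g ws x y > \<epsilon>"
      using assms(2) by (auto simp: separated_on_def)
    have "inj_on code E"
    proof (rule inj_onI, rule ccontr)
      fix x y assume xy: "x \<in> E" "y \<in> E" "code x = code y" "x \<noteq> y"
      have "dword g ws x y \<le> \<epsilon>"
        unfolding dword_le_iff
      proof (intro allI impI)
        fix j assume j: "j \<le> length ws"
        let ?a = "orbit_pt g ws j x" and ?b = "orbit_pt g ws j y"
        have "f ?a = f ?b" using fun_cong[OF xy(3), of j] j by (simp add: code_def)
        moreover have "dist (f ?a) ?a < \<epsilon> / 2" "dist (f ?b) ?b < \<epsilon> / 2"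
          using f orbit_pt_in[OF _ assms(1)] xy E(1) by blast+
        ultimately show "dist ?a ?b \<le> \<epsilon>"
          using dist_triangle3[of ?a ?b "f ?b"] by simp
      qed
      then show False using E(2)[OF xy(1,2,4)] by simp
    qed
    moreover have "code ` E \<subseteq> {..length ws} \<rightarrow>\<^sub>E C" using E(1) code by blast
    ultimately show "card E \<le> card ({..length ws} \<rightarrow>\<^sub>E C)"
      using card_inj_on_le fin by blast
  qed
qed

text \<open>\<open>sep_card\<close> is a \<open>Sup\<close> of natural numbers and means the maximal
  cardinality only when these are bounded. Total boundedness of X gives the bound, and the supremum
  becomes a maximum.\<close>

lemma
  assumes "set ws \<subseteq> {..<p}" "K \<subseteq> X" "0 < \<epsilon>"
  shows card_le_sep_card: "separated_on g K ws \<epsilon> E \<Longrightarrow> card E \<le> sep_card g K ws \<epsilon>"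
    and sep_card_attained: "\<exists>E. separated_on g K ws \<epsilon> E \<and> card E = sep_card g K ws \<epsilon>"
proof -
  let ?A = "card ` Collect (separated_on g K ws \<epsilon>)"
  obtain N where "\<And>E. separated_on g K ws \<epsilon> E \<Longrightarrow> card E \<le> N"
    using separated_on_card_bounded[OF assms] by blast
  then have "?A \<subseteq> {..N}" by auto
  then have fin: "finite ?A" by (rule finite_subset) simp
  moreover have "separated_on g K ws \<epsilon> {}" by (simp add: separated_on_def)
  then have ne: "?A \<noteq> {}" by blast
  ultimately have eq: "sep_card g K ws \<epsilon> = Max ?A" unfolding sep_card_eq by (simp add: cSup_eq_Max)
  show "card E \<le> sep_card g K ws \<epsilon>" if "separated_on g K ws \<epsilon> E"
    unfolding eq using fin that by (intro Max_ge) auto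
  have "Max ?A \<in> ?A" by (rule Max_in[OF fin ne])
  then show "\<exists>E. separated_on g K ws \<epsilon> E \<and> card E = sep_card g K ws \<epsilon>" unfolding eq by auto
qed

text \<open>A separated set of maximal cardinality is spanning: a point farther than \<epsilon> from
  all its members could be added to it.\<close>

lemma sep_card_spanning:
  assumes "set ws \<subseteq> {..<p}" "K \<subseteq> X" "0 < \<epsilon>"
  shows "\<exists>E. finite E \<and> card E = sep_card g K ws \<epsilon> \<and> (\<forall>y\<in>K. \<exists>e\<in>E. dword g ws y e \<le> \<epsilon>)"
proof -
  obtain E where E: "separated_on g K ws \<epsilon> E" "card E = sep_card g K ws \<epsilon>"
    using sep_card_attained[OF assms] by blast
  have "\<exists>e\<in>E. dword g ws y e \<le> \<epsilon>" if "y \<in> K" for y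
  proof (rule ccontr)
    assume "\<not> (\<exists>e\<in>E. dword g ws y e \<le> \<epsilon>)"
    then have far: "\<And>e. e \<in> E \<Longrightarrow> dword g ws y e > \<epsilon>" by force
    have far': "dword g ws e y > \<epsilon>" if "e \<in> E" for e
      using far[OF that] unfolding dword_def by (simp add: dist_commute)
    have "dword g ws y y \<le> \<epsilon>" using assms(3) by (simp add: dword_le_iff)
    then have "y \<notin> E" using far by force
    moreover have "separated_on g K ws \<epsilon> (insert y E)"
      using E(1) far far' that unfolding separated_on_def by auto
    then have "card (insert y E) \<le> sep_card g K ws \<epsilon>" by (rule card_le_sep_card[OF assms])
    ultimately show False using E by (simp add: separated_on_def)
  qed
  then show ?thesis using E unfolding separated_on_def by blast
qed

lemma sep_card_pos:
  assumes "set ws \<subseteq> {..<p}" "K \<subseteq> X" "0 < \<epsilon>" "K \<noteq> {}"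
  shows "1 \<le> sep_card g K ws \<epsilon>"
proof -
  obtain y where "y \<in> K" using assms(4) by blast
  then have "separated_on g K ws \<epsilon> {y}" by (simp add: separated_on_def)
  then show ?thesis using card_le_sep_card[OF assms(1-3), of "{y}"] by simp
qed

lemma sep_card_antimono:
  assumes "set ws \<subseteq> {..<p}" "K \<subseteq> X" "0 < \<epsilon>" "\<epsilon> \<le> \<epsilon>'"
  shows "sep_card g K ws \<epsilon>' \<le> sep_card g K ws \<epsilon>"
proof -
  have "0 < \<epsilon>'" using assms by simp
  then obtain E where E: "separated_on g K ws \<epsilon>' E" "card E = sep_card g K ws \<epsilon>'"
    using sep_card_attained assms by blast
  have "separated_on g K ws \<epsilon> E" using E(1) assms(4) unfolding separated_on_def by fastforce
  then show ?thesis using card_le_sep_card[OF assms(1-3)] E(2) by metis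
qed

section \<open>Averages over words and the limit in \<epsilon>\<close>

lemma finite_words: "finite (words p n)"
  unfolding words_def using finite_lists_length_eq[of "{..<p}" n] by (simp add: conj_commute)

lemma card_words: "card (words p n) = p ^ n"
  unfolding words_def using card_lists_length_eq[of "{..<p}" n] by (simp add: conj_commute)

text \<open>Keeps the argument of the logarithm in \<open>S_d\<close> away from 0, so that the
  logarithm is monotone there and takes nonnegative values.\<close>

lemma S_n_ge_1:
  assumes "K \<subseteq> X" "0 < \<epsilon>" "K \<noteq> {}"
  shows "1 \<le> S_n p g K \<epsilon> n"
proof -
  have "real (p ^ n) = (\<Sum>ws\<in>words p n. 1)" by (simp add: card_words)
  also have "\<dots> \<le> (\<Sum>ws\<in>words p n. real (sep_card g K ws \<epsilon>))"
    using sep_card_pos[OF _ assms] by (intro sum_mono) (auto simp: words_def)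
  finally show ?thesis using p_pos by (simp add: S_n_def)
qed

lemma S_d_antimono:
  assumes "K \<subseteq> X" "0 < \<epsilon>" "\<epsilon> \<le> \<epsilon>'" "K \<noteq> {}"
  shows "S_d p g K \<epsilon>' \<le> S_d p g K \<epsilon>"
  unfolding S_d_def
proof (rule Limsup_mono, rule always_eventually, rule allI)
  fix n
  have le: "S_n p g K \<epsilon>' n \<le> S_n p g K \<epsilon> n"
    unfolding S_n_def using sep_card_antimono[OF _ assms(1-3)]
    by (intro divide_right_mono sum_mono) (auto simp: words_def)
  have "1 \<le> S_n p g K \<epsilon>' n" using assms by (intro S_n_ge_1) auto
  then show "ereal (ln (S_n p g K \<epsilon>' n) / real n) \<le> ereal (ln (S_n p g K \<epsilon> n) / real n)"
    using le by (simp add: divide_right_mono)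
qed

text \<open>\<open>S_d\<close> grows as \<epsilon> decreases, so the limit defining
  \<open>h_top\<close> exists in the extended reals and equals the supremum over all positive
  \<epsilon>.\<close>

lemma h_top_ge_S_d:
  assumes "K \<subseteq> X" "0 < \<epsilon>" "K \<noteq> {}"
  shows "S_d p g K \<epsilon> \<le> h_top p g K"
proof -
  define L where "L = (SUP \<epsilon>\<in>{0<..}. S_d p g K \<epsilon>)"
  have "((\<lambda>\<epsilon>. S_d p g K \<epsilon>) \<longlongrightarrow> L) (at_right 0)"
  proof (rule order_tendstoI)
    fix a assume "a < L"
    then obtain e where e: "e > 0" "a < S_d p g K e" unfolding L_def less_SUP_iff by auto
    have "\<forall>\<^sub>F \<epsilon> in at_right 0. \<epsilon> < e" "\<forall>\<^sub>F \<epsilon> in at_right (0::real). 0 < \<epsilon>"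
      using e(1) by (auto intro: eventually_at_right_less order_tendstoD(2)[OF tendsto_ident_at])
    then show "\<forall>\<^sub>F \<epsilon> in at_right 0. a < S_d p g K \<epsilon>"
    proof eventually_elim
      case (elim \<epsilon>)
      then have "S_d p g K e \<le> S_d p g K \<epsilon>" using assms by (intro S_d_antimono) auto
      then show ?case using e(2) by order
    qed
  next
    fix a assume a: "L < a"
    have "\<forall>\<^sub>F \<epsilon> in at_right (0::real). 0 < \<epsilon>" by (simp add: eventually_at_right_less)
    then show "\<forall>\<^sub>F \<epsilon> in at_right 0. S_d p g K \<epsilon> < a"
    proof eventually_elim
      case (elim \<epsilon>)
      then have "S_d p g K \<epsilon> \<le> L" unfolding L_def by (intro SUP_upper) auto
      then show ?case using a by order
    qed
  qed
  then have "h_top p g K = L" unfolding h_top_def by (intro tendsto_Lim) auto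
  moreover have "S_d p g K \<epsilon> \<le> L" unfolding L_def using assms by (intro SUP_upper) auto
  ultimately show ?thesis by simp
qed

end

section \<open>Images of a compact set under the semigroup\<close>

text \<open>All lengths up to m are collected so that the sets increase with m. Each is a finite
  union of continuous images, hence compact whenever F is a compact subset of X.\<close>

definition word_images :: "nat \<Rightarrow> (nat \<Rightarrow> 'a \<Rightarrow> 'a) \<Rightarrow> 'a set \<Rightarrow> nat \<Rightarrow> 'a set" where
  "word_images p g F m = (\<Union>n\<le>m. \<Union>ws\<in>words p n. orbit_pt g ws n ` F)"

context semigroup_action
begin

lemma compact_word_images:
  assumes "compact F" "F \<subseteq> X"
  shows "compact (word_images p g F m)"
proof -
  have "compact (orbit_pt g ws n ` F)" if "ws \<in> words p n" for ws n
    using that assms continuous_on_orbit_pt[of ws n] 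
    by (intro compact_continuous_image) (auto simp: words_def intro: continuous_on_subset)
  then show ?thesis unfolding word_images_def
    by (intro compact_UN finite_words) auto
qed

lemma word_images_subset: "F \<subseteq> X \<Longrightarrow> word_images p g F m \<subseteq> X"
  unfolding word_images_def words_def using orbit_pt_in by blast

lemma word_images_step:
  assumes "x \<in> word_images p g F m" "i < p"
  shows "g i x \<in> word_images p g F (Suc m)"
proof -
  obtain n ws y where n: "n \<le> m" "ws \<in> words p n" "y \<in> F" "x = orbit_pt g ws n y"
    using assms(1) by (auto simp: word_images_def)
  have "g i x = orbit_pt g (ws @ [i]) (Suc n) y"
    using n by (simp add: orbit_pt_def words_def)
  moreover have "ws @ [i] \<in> words p (Suc n)" using n assms(2) by (auto simp: words_def)
  ultimately show ?thesis using n unfolding word_images_def by blast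
qed

lemma Pi_setD:
  assumes "\<mu> \<in> Pi_set p X g \<nu>"
  shows "prob_space \<mu>" "sets \<mu> = sets (skew_space p X)" "invariant_measure \<mu> (skew_map g)"
    "snd \<in> measurable \<mu> (restrict_space borel X)"
    "\<And>A. A \<in> sets (restrict_space borel X) \<Longrightarrow> measure \<nu> A = measure \<mu> (snd -` A \<inter> space \<mu>)"
    "\<And>z. z \<in> space \<mu> \<Longrightarrow> (\<forall>i. fst z i < p) \<and> snd z \<in> X"
proof -
  show sets: "prob_space \<mu>" "sets \<mu> = sets (skew_space p X)" "invariant_measure \<mu> (skew_map g)"
    using assms by (auto simp: Pi_set_def)
  show snd: "snd \<in> measurable \<mu> (restrict_space borel X)"
    unfolding measurable_cong_sets[OF sets(2) refl] skew_space_def by simp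
  have "distr \<mu> (restrict_space borel X) snd = \<nu>" using assms by (simp add: Pi_set_def)
  then show "measure \<nu> A = measure \<mu> (snd -` A \<inter> space \<mu>)" if "A \<in> sets (restrict_space borel X)" for A
    using measure_distr[OF snd that] by simp
  fix z assume "z \<in> space \<mu>"
  then have "z \<in> space (skew_space p X)" using sets_eq_imp_space_eq[OF sets(2)] by simp
  then show "(\<forall>i. fst z i < p) \<and> snd z \<in> X"
    unfolding skew_space_def shift_space_def
    by (auto simp: space_pair_measure space_PiM space_restrict_space)
qed

lemma sets_compact:
  assumes "compact C" "C \<subseteq> X"
  shows "C \<in> sets (restrict_space borel X)"
proof -
  have "C \<in> sets borel" "X \<in> sets borel"
    using assms compact by (simp_all add: borel_closed compact_imp_closed)
  then show ?thesis using assms(2) by (simp add: sets_restrict_space_iff)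
qed

lemma word_images_exhaust:
  assumes "\<mu> \<in> Pi_erg p X g \<nu>" "prob_space \<nu>" "sets \<nu> = sets (restrict_space borel X)"
    and "compact F" "F \<subseteq> X" "0 < measure \<nu> F" "0 < \<eta>"
  shows "\<exists>m. measure \<nu> (X - word_images p g F m) < \<eta>"
proof -
  let ?T = "skew_map g"
  interpret \<nu>: prob_space \<nu> by fact
  have \<mu>: "\<mu> \<in> Pi_set p X g \<nu>" and erg: "ergodic \<mu> ?T" using assms(1) by (auto simp: Pi_erg_def)
  note P = Pi_setD[OF \<mu>]
  interpret prob_space \<mu> by (rule P(1))
  have T: "?T \<in> measurable \<mu> \<mu>" using P(3) by (simp add: invariant_measure_def)
  have sV: "word_images p g F m \<in> sets (restrict_space borel X)" for m
    by (rule sets_compact[OF compact_word_images word_images_subset]) fact+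
  define U where "U = (\<Union>m. word_images p g F m)"
  have sU: "U \<in> sets (restrict_space borel X)" unfolding U_def using sV by auto
  define A where "A = snd -` U \<inter> space \<mu>"
  have sA: "A \<in> sets \<mu>" unfolding A_def by (rule measurable_sets[OF P(4) sU])
  have step: "?T z \<in> A" if "z \<in> A" for z
  proof -
    have z: "z \<in> space \<mu>" "snd z \<in> U" using that by (auto simp: A_def)
    have "g (fst z 0) (snd z) \<in> U"
      using z(2) P(6)[OF z(1)] word_images_step unfolding U_def by blast
    moreover have "?T z \<in> space \<mu>" using measurable_space[OF T z(1)] .
    ultimately show ?thesis by (simp add: A_def skew_map_def split_beta)
  qed
  \<comment> \<open>\<open>ergodic\<close> speaks of sets equal to their preimage, while A is only
    contained in its own. The preimages \<open>A' k\<close> increase and all have the measure of A,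
    so their union is strictly invariant and still has that measure.\<close>
  define A' where "A' k = (?T ^^ k) -` A \<inter> space \<mu>" for k
  have inv: "invariant_measure \<mu> (?T ^^ k)" for k by (rule invariant_measure_funpow[OF P(3)])
  have sA': "A' k \<in> sets \<mu>" for k
    unfolding A'_def using inv[of k] sA by (auto simp: invariant_measure_def intro: measurable_sets)
  have mA': "measure \<mu> (A' k) = measure \<mu> A" for k
    unfolding A'_def by (rule invariant_measure_vimage[OF inv sA])
  have inc: "A' k \<subseteq> A' (Suc k)" for k
    unfolding A'_def using step by auto
  have "(\<lambda>k. measure \<mu> (A' k)) \<longlonglongrightarrow> measure \<mu> (\<Union>k. A' k)"
    by (rule finite_Lim_measure_incseq) (use sA' inc in \<open>auto intro!: incseq_SucI\<close>)
  then have mU: "measure \<mu> (\<Union>k. A' k) = measure \<mu> A"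
    using LIMSEQ_unique[OF _ tendsto_const[of "measure \<mu> A"]] by (simp add: mA')
  have "?T -` A' k \<inter> space \<mu> = A' (Suc k)" for k
    unfolding A'_def funpow_Suc_right vimage_def comp_def using measurable_space[OF T] by blast
  then have "?T -` (\<Union>k. A' k) \<inter> space \<mu> = (\<Union>k. A' (Suc k))" by blast
  also have "\<dots> = (\<Union>k. A' k)" using inc by blast
  finally have "?T -` (\<Union>k. A' k) \<inter> space \<mu> = (\<Union>k. A' k)" .
  moreover have "(\<Union>k. A' k) \<in> sets \<mu>" using sA' by auto
  ultimately have "measure \<mu> (\<Union>k. A' k) = 0 \<or> measure \<mu> (\<Union>k. A' k) = 1"
    using erg unfolding ergodic_def by blast
  moreover have "measure \<mu> A = measure \<nu> U" unfolding A_def using P(5)[OF sU] by simp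
  moreover have "measure \<nu> F \<le> measure \<nu> U"
  proof (rule \<nu>.finite_measure_mono)
    have "F \<subseteq> word_images p g F 0" by (auto simp: word_images_def words_def orbit_pt_def)
    then show "F \<subseteq> U" by (auto simp: U_def)
  qed (use sU assms(3) in simp)
  ultimately have U1: "measure \<nu> U = 1" using mU assms(6) by auto
  have "(\<lambda>m. measure \<nu> (word_images p g F m)) \<longlonglongrightarrow> measure \<nu> U"
    unfolding U_def
  proof (rule \<nu>.finite_Lim_measure_incseq)
    show "range (word_images p g F) \<subseteq> sets \<nu>" using sV assms(3) by auto
    show "incseq (word_images p g F)"
      unfolding word_images_def by (intro incseq_SucI UN_mono) auto
  qed
  then have "\<forall>\<^sub>F m in sequentially. 1 - \<eta> < measure \<nu> (word_images p g F m)"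
    using U1 assms(7) by (intro order_tendstoD(1)) auto
  then obtain m where m: "1 - \<eta> < measure \<nu> (word_images p g F m)" by (auto simp: eventually_sequentially)
  have "space \<nu> = X" using sets_eq_imp_space_eq[OF assms(3)] by (simp add: space_restrict_space)
  then have "measure \<nu> (X - word_images p g F m) = 1 - measure \<nu> (word_images p g F m)"
    using \<nu>.prob_compl[of "word_images p g F m"] sV assms(3) by simp
  then show ?thesis using m by (intro exI[of _ m]) simp
qed

end

text \<open>Markov's inequality for the number of times before n spent outside B, whose integral is
  n times the measure of the complement by invariance. Taking that measure at most \<eta>^2 later
  leaves a bad set of measure at most \<eta>.\<close>

lemma measure_many_visits_le:
  assumes "prob_space \<mu>" "invariant_measure \<mu> T" "B \<in> sets \<mu>" "0 < \<eta>" "0 < n"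
  shows "{z \<in> space \<mu>. \<eta> * real n \<le> real (card {i. i < n \<and> (T ^^ i) z \<notin> B})} \<in> sets \<mu>"
    and "measure \<mu> {z \<in> space \<mu>. \<eta> * real n \<le> real (card {i. i < n \<and> (T ^^ i) z \<notin> B})}
      \<le> measure \<mu> (space \<mu> - B) / \<eta>"
proof -
  interpret prob_space \<mu> by fact
  define D where "D i = (T ^^ i) -` (space \<mu> - B) \<inter> space \<mu>" for i
  have inv: "invariant_measure \<mu> (T ^^ i)" for i by (rule invariant_measure_funpow[OF assms(2)])
  then have Ti: "T ^^ i \<in> measurable \<mu> \<mu>" for i by (simp add: invariant_measure_def)
  have sB: "space \<mu> - B \<in> sets \<mu>" using assms(3) by auto
  have sD: "D i \<in> sets \<mu>" for i unfolding D_def by (rule measurable_sets[OF Ti sB])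
  have mD: "measure \<mu> (D i) = measure \<mu> (space \<mu> - B)" for i
    unfolding D_def by (rule invariant_measure_vimage[OF inv sB])
  define u where "u z = (\<Sum>i<n. indicator (D i) z :: real)" for z
  have card_u: "real (card {i. i < n \<and> (T ^^ i) z \<notin> B}) = u z" if "z \<in> space \<mu>" for z
  proof -
    have "z \<in> D i \<longleftrightarrow> (T ^^ i) z \<notin> B" for i
      using measurable_space[OF Ti that] that by (auto simp: D_def)
    then have "u z = (\<Sum>i<n. if (T ^^ i) z \<notin> B then 1 else 0)"
      by (simp add: u_def indicator_def of_bool_def)
    then show ?thesis by (simp add: sum.If_cases Int_def)
  qed
  have eq: "{z \<in> space \<mu>. \<eta> * real n \<le> real (card {i. i < n \<and> (T ^^ i) z \<notin> B})}
      = {z \<in> space \<mu>. \<eta> * real n \<le> u z}" using card_u by auto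
  have u_meas: "u \<in> borel_measurable \<mu>" unfolding u_def using sD by measurable
  then show "{z \<in> space \<mu>. \<eta> * real n \<le> real (card {i. i < n \<and> (T ^^ i) z \<notin> B})} \<in> sets \<mu>"
    unfolding eq by measurable
  have intu: "integrable \<mu> u" unfolding u_def using sD by (auto simp: emeasure_eq_measure)
  have "(\<integral>z. u z \<partial>\<mu>) = (\<Sum>i<n. measure \<mu> (D i))"
    unfolding u_def using sD by (subst Bochner_Integration.integral_sum) (auto simp: emeasure_eq_measure)
  then have I: "(\<integral>z. u z \<partial>\<mu>) = real n * measure \<mu> (space \<mu> - B)" by (simp add: mD)
  have "measure \<mu> {z \<in> space \<mu>. \<eta> * real n \<le> u z} \<le> (\<integral>z. u z \<partial>\<mu>) / (\<eta> * real n)"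
    by (rule integral_Markov_inequality_measure[OF intu sets.top])
      (use assms in \<open>auto simp: u_def intro!: sum_nonneg\<close>)
  then show "measure \<mu> {z \<in> space \<mu>. \<eta> * real n \<le> real (card {i. i < n \<and> (T ^^ i) z \<notin> B})}
      \<le> measure \<mu> (space \<mu> - B) / \<eta>"
    unfolding eq using assms(5) by (simp add: I field_simps)
qed

section \<open>Coding itineraries and the entropy estimate\<close>

context semigroup_action
begin

text \<open>Time i of the skew product is time l + i along the concatenated word. There both orbits
  are within \<epsilon> of the orbit of the same point e, which explains 2 \<epsilon>.\<close>

lemma dist_funpow_skew_map_le:
  assumes "length ws = l" "snd z = orbit_pt g ws l y" "snd z' = orbit_pt g ws l y'" "i \<le> n"
    and eq: "\<And>k. k < n \<Longrightarrow> fst z k = fst z' k"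
    and "dword g (ws @ map (fst z) [0..<n]) y e \<le> \<epsilon>" "dword g (ws @ map (fst z) [0..<n]) y' e \<le> \<epsilon>"
  shows "dist (snd ((skew_map g ^^ i) z)) (snd ((skew_map g ^^ i) z')) \<le> 2 * \<epsilon>"
proof -
  define v where "v = ws @ map (fst z) [0..<n]"
  have map_eq: "map (fst z') [0..<n] = map (fst z) [0..<n]" using eq by auto
  have orb: "orbit_pt g v (l + i) u = orbit_pt g (map (fst z) [0..<n]) i (orbit_pt g ws l u)" for u
    unfolding v_def using orbit_pt_append[of g ws] assms(1) by simp
  have "snd ((skew_map g ^^ i) z) = orbit_pt g v (l + i) y"
    using skew_map_funpow[OF assms(4), of g "fst z" "snd z", unfolded prod.collapse] by (simp add: orb assms(2))
  moreover have "snd ((skew_map g ^^ i) z') = orbit_pt g v (l + i) y'"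
    using skew_map_funpow[OF assms(4), of g "fst z'" "snd z'", unfolded prod.collapse] by (simp add: orb assms(3) map_eq)
  moreover have "l + i \<le> length v" using assms(1,4) by (simp add: v_def)
  then have "dist (orbit_pt g v (l + i) y) (orbit_pt g v (l + i) e) \<le> \<epsilon>"
    "dist (orbit_pt g v (l + i) y') (orbit_pt g v (l + i) e) \<le> \<epsilon>"
    using assms(6,7) unfolding v_def[symmetric] dword_le_iff by blast+
  ultimately show ?thesis
    using dist_triangle2[of "orbit_pt g v (l + i) y" "orbit_pt g v (l + i) y'" "orbit_pt g v (l + i) e"]
    by simp
qed

text \<open>A point (\<omega>, x) with x = g_w y, y \<in> F, is coded by the length of w, the word v formed by w and an
  initial segment of \<omega>, and a point e of a (v, \<epsilon>)-spanning subset of K close to y. Equal codes force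
  the itineraries to agree whenever both orbits are in B.\<close>

lemma card_itineraries_le:
  fixes t :: real and a :: "(nat \<Rightarrow> nat) \<times> 'a \<Rightarrow> 'b"
  assumes "finite P" "0 < t" "t \<le> 1" "K \<subseteq> X" "F \<subseteq> K" "0 < \<epsilon>" "0 \<le> \<eta>"
    and Y: "\<And>z. z \<in> Y \<Longrightarrow> (\<forall>i. fst z i < p) \<and> snd z \<in> word_images p g F m
          \<and> real (card {i. i < n \<and> (skew_map g ^^ i) z \<notin> B}) \<le> \<eta> * real n"
    and aP: "\<And>z i. z \<in> Y \<Longrightarrow> a ((skew_map g ^^ i) z) \<in> P"
    and const: "\<And>z z'. z \<in> B \<Longrightarrow> z' \<in> B \<Longrightarrow> (\<forall>i<m'. fst z i = fst z' i) \<Longrightarrow>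
          dist (snd z) (snd z') \<le> 2 * \<epsilon> \<Longrightarrow> a z = a z'"
  defines "L \<equiv> n + m' + m"
  shows "t ^ nat \<lfloor>2 * \<eta> * real n\<rfloor> * real (card ((\<lambda>z. restrict (\<lambda>i. a ((skew_map g ^^ i) z)) {..<n}) ` Y))
    \<le> real (Suc m) * (real p ^ L * S_n p g K \<epsilon> L) * (1 + real (card P) * t) ^ n"
proof -
  let ?T = "skew_map g"
  have "\<forall>v\<in>words p L. \<exists>E. finite E \<and> card E = sep_card g K v \<epsilon> \<and> (\<forall>y\<in>K. \<exists>e\<in>E. dword g v y e \<le> \<epsilon>)"
    using sep_card_spanning[OF _ assms(4,6)] by (auto simp: words_def)
  then obtain E where E: "\<And>v. v \<in> words p L \<Longrightarrow> finite (E v)"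
    "\<And>v. v \<in> words p L \<Longrightarrow> card (E v) = sep_card g K v \<epsilon>"
    "\<And>v y. v \<in> words p L \<Longrightarrow> y \<in> K \<Longrightarrow> \<exists>e\<in>E v. dword g v y e \<le> \<epsilon>" by metis
  \<comment> \<open>The prefix is filled up to the common length L whatever its own length. At least
    n + m' symbols of the base point remain: n for the iterates, and m' more so that the cylinder of
    length m' is still visible at times close to n.\<close>
  define word where "word z ws = ws @ map (fst z) [0..<L - length ws]" for z :: "(nat \<Rightarrow> nat) \<times> 'a" and ws
  have "\<exists>ws y e. length ws \<le> m \<and> set ws \<subseteq> {..<p} \<and> snd z = orbit_pt g ws (length ws) y
      \<and> word z ws \<in> words p L \<and> e \<in> E (word z ws) \<and> dword g (word z ws) y e \<le> \<epsilon>" if zY: "z \<in> Y" for z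
  proof -
    obtain l ws y where l: "l \<le> m" "ws \<in> words p l" "y \<in> F" "snd z = orbit_pt g ws l y"
      using Y[OF zY] by (auto simp: word_images_def)
    have len: "length ws = l" "set ws \<subseteq> {..<p}" using l(2) by (auto simp: words_def)
    have w: "word z ws \<in> words p L"
      using len l(1) Y[OF zY] by (auto simp: word_def words_def L_def)
    then obtain e where "e \<in> E (word z ws)" "dword g (word z ws) y e \<le> \<epsilon>"
      using E(3) l(3) assms(5) by blast
    then show ?thesis using l len w by blast
  qed
  then obtain ws y e where c: "\<And>z. z \<in> Y \<Longrightarrow> length (ws z) \<le> m"
    "\<And>z. z \<in> Y \<Longrightarrow> snd z = orbit_pt g (ws z) (length (ws z)) (y z)"
    "\<And>z. z \<in> Y \<Longrightarrow> word z (ws z) \<in> words p L" "\<And>z. z \<in> Y \<Longrightarrow> e z \<in> E (word z (ws z))"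
    "\<And>z. z \<in> Y \<Longrightarrow> dword g (word z (ws z)) (y z) (e z) \<le> \<epsilon>" by metis
  \<comment> \<open>The length component tells where the long word splits; without it, equal words
    would not force equal prefixes.\<close>
  define code where "code z = (length (ws z), word z (ws z), e z)" for z
  define I where "I = {..m} \<times> Sigma (words p L) E"
  have finI: "finite I" unfolding I_def using E(1) finite_words by auto
  have "card (Sigma (words p L) E) = (\<Sum>v\<in>words p L. sep_card g K v \<epsilon>)"
    using E(1,2) by (subst card_SigmaI) (auto simp: finite_words)
  then have cardI: "real (card I) = real (Suc m) * (real p ^ L * S_n p g K \<epsilon> L)"
    using p_pos by (simp add: I_def card_cartesian_product S_n_def distrib_right)
  have "card {i. i < n \<and> restrict (\<lambda>i. a ((?T ^^ i) z')) {..<n} i \<noteq> restrict (\<lambda>i. a ((?T ^^ i) z)) {..<n} i}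
      \<le> nat \<lfloor>2 * \<eta> * real n\<rfloor>" (is "card ?D \<le> _")
    if z: "z \<in> Y" "z' \<in> Y" "code z = code z'" for z z'
  proof -
    define l where "l = length (ws z)"
    define N where "N = L - l"
    have lm: "l \<le> m" using c(1) z by (simp add: l_def)
    have len: "length (ws z') = l" using z(3) by (simp add: code_def l_def)
    have weq: "ws z @ map (fst z) [0..<N] = ws z' @ map (fst z') [0..<N]"
      using z(3) len by (simp add: code_def word_def N_def l_def)
    then have ws: "ws z' = ws z" and "map (fst z) [0..<N] = map (fst z') [0..<N]"
      using len by (simp_all add: l_def)
    then have fst_eq: "fst z k = fst z' k" if "k < N" for k
      using that by (metis diff_zero length_upt nth_map_upt add_0)
    have nN: "n + m' \<le> N" using lm by (simp add: N_def L_def)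
    have e: "e z' = e z" using z(3) by (simp add: code_def)
    have same: "a ((?T ^^ i) z) = a ((?T ^^ i) z')"
      if i: "i < n" "(?T ^^ i) z \<in> B" "(?T ^^ i) z' \<in> B" for i
    proof (rule const[OF i(2,3)])
      have iN: "i \<le> N" using i nN by simp
      have f: "fst ((?T ^^ i) u) = (\<lambda>k. fst u (k + i))" for u
        using skew_map_funpow[OF order_refl, where x = "snd u" and \<omega> = "fst u" and g = g] by simp
      show "\<forall>k<m'. fst ((?T ^^ i) z) k = fst ((?T ^^ i) z') k"
        unfolding f using fst_eq nN i(1) by simp
      show "dist (snd ((?T ^^ i) z)) (snd ((?T ^^ i) z')) \<le> 2 * \<epsilon>"
      proof (rule dist_funpow_skew_map_le[OF _ _ _ iN fst_eq])
        show "length (ws z) = l" by (simp add: l_def)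
        show "snd z = orbit_pt g (ws z) l (y z)" "snd z' = orbit_pt g (ws z) l (y z')"
          using c(2)[OF z(1)] c(2)[OF z(2)] ws by (simp_all add: l_def)
        show "dword g (ws z @ map (fst z) [0..<N]) (y z) (e z) \<le> \<epsilon>"
          using c(5)[OF z(1)] by (simp add: word_def N_def l_def)
        show "dword g (ws z @ map (fst z) [0..<N]) (y z') (e z) \<le> \<epsilon>"
          unfolding weq using c(5)[OF z(2)] len by (simp add: word_def N_def e)
      qed
    qed
    \<comment> \<open>Names can differ only at a time when one of the two orbits is outside B. Each
      orbit contributes at most \<eta> n such times, whence the Hamming radius 2 \<eta> n.\<close>
    have "?D \<subseteq> {i. i < n \<and> (?T ^^ i) z \<notin> B} \<union> {i. i < n \<and> (?T ^^ i) z' \<notin> B}"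
      using same by auto
    then have "card ?D \<le> card ({i. i < n \<and> (?T ^^ i) z \<notin> B} \<union> {i. i < n \<and> (?T ^^ i) z' \<notin> B})"
      by (intro card_mono) auto
    also have "\<dots> \<le> card {i. i < n \<and> (?T ^^ i) z \<notin> B} + card {i. i < n \<and> (?T ^^ i) z' \<notin> B}"
      by (rule card_Un_le)
    finally have "real (card ?D) \<le> 2 * \<eta> * real n" using Y[OF z(1)] Y[OF z(2)] by linarith
    then show ?thesis by (simp add: le_nat_floor)
  qed
  moreover have "code z \<in> I" if "z \<in> Y" for z
    using c(1,3,4) that by (auto simp: code_def I_def)
  moreover have "restrict (\<lambda>i. a ((?T ^^ i) z)) {..<n} \<in> {..<n} \<rightarrow>\<^sub>E P" if "z \<in> Y" for z
    using aP[OF that] by auto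
  ultimately show ?thesis
    unfolding cardI[symmetric] by (intro card_names_le[where code = code] finI assms(1-3)) auto
qed

text \<open>The three error terms have separate sources: k t is the growth of the Hamming weights, 2
  \<eta> ln (1/t) comes from the radius of the balls, and 2 \<eta> ln k pays for the atoms that
  contain no good point. The length L exceeds n by the look-ahead m' and the prefix length
  m.\<close>

lemma partition_entropy_iter_join_le:
  fixes t :: real
  assumes \<mu>: "\<mu> \<in> Pi_set p X g \<nu>" and P: "finite_partition \<mu> P"
    and B: "B \<in> sets \<mu>" "measure \<mu> (space \<mu> - B) \<le> \<eta>\<^sup>2" "cylinder_constant_on B m' \<epsilon>\<^sub>1 P"
    and K: "K \<subseteq> X" "F \<subseteq> K" "F \<noteq> {}" "compact F" "measure \<nu> (X - word_images p g F m) \<le> \<eta>"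
    and "0 < t" "t \<le> 1" "0 < \<epsilon>" "2 * \<epsilon> \<le> \<epsilon>\<^sub>1" "0 < \<eta>" "0 < n"
  defines "L \<equiv> n + m' + m" and "k \<equiv> real (card P)"
  shows "partition_entropy \<mu> (iter_join \<mu> (skew_map g) P n)
    \<le> ln 2 + ln (real (Suc m)) + real L * ln (real p) + ln (S_n p g K \<epsilon> L)
      + real n * (k * t + 2 * \<eta> * ln (1 / t) + 2 * \<eta> * ln k)"
proof -
  let ?T = "skew_map g" and ?V = "word_images p g F m"
  note M = Pi_setD[OF \<mu>]
  interpret prob_space \<mu> by (rule M(1))
  have T: "?T \<in> measurable \<mu> \<mu>" using M(3) by (simp add: invariant_measure_def)
  have Ti: "(?T ^^ i) z \<in> space \<mu>" if "z \<in> space \<mu>" for z i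
    using that by (induction i) (auto intro: measurable_space[OF T])
  have Pp: "finite P" "P \<subseteq> sets \<mu>" "\<Union>P = space \<mu>"
    "\<And>A B. A \<in> P \<Longrightarrow> B \<in> P \<Longrightarrow> A \<noteq> B \<Longrightarrow> A \<inter> B = {}"
    using P by (auto simp: finite_partition_def)
  have "P \<noteq> {}" using Pp(3) not_empty by auto
  then have k1: "1 \<le> k" using Pp(1) by (simp add: k_def Suc_le_eq card_gt_0_iff)
  define a where "a z = (THE A. A \<in> P \<and> z \<in> A)" for z
  have a_eq: "a z = A" if "A \<in> P" "z \<in> A" for z A
    unfolding a_def using that Pp(4) by (intro the_equality) auto
  have a_mem: "a z \<in> P \<and> z \<in> a z" if z: "z \<in> space \<mu>" for z
  proof -
    obtain A where "A \<in> P" "z \<in> A" using z Pp(3) by blast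
    then show ?thesis using a_eq by simp
  qed
  have FX: "F \<subseteq> X" using K by auto
  have sV: "?V \<in> sets (restrict_space borel X)"
    by (rule sets_compact[OF compact_word_images word_images_subset]) (use K FX in auto)
  have sX: "X \<in> sets (restrict_space borel X)" by (rule sets_compact[OF compact order_refl])
  define W where "W = {z \<in> space \<mu>. \<eta> * real n \<le> real (card {i. i < n \<and> (?T ^^ i) z \<notin> B})}"
  define W' where "W' = snd -` (X - ?V) \<inter> space \<mu>"
  \<comment> \<open>The good points: few visits outside B, and fibre coordinate in a word image of
    F. Each of the two excluded sets has measure at most \<eta>.\<close>
  define Y where "Y = space \<mu> - (W \<union> W')"
  have sW: "W \<in> sets \<mu>" and mW: "measure \<mu> W \<le> \<eta>"
  proof -
    note mv = measure_many_visits_le[OF M(1,3) B(1) \<open>0 < \<eta>\<close> \<open>0 < n\<close>]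
    show "W \<in> sets \<mu>" unfolding W_def by (rule mv(1))
    have "measure \<mu> W \<le> measure \<mu> (space \<mu> - B) / \<eta>" unfolding W_def by (rule mv(2))
    also have "\<dots> \<le> \<eta>\<^sup>2 / \<eta>" using B(2) \<open>0 < \<eta>\<close> by (intro divide_right_mono) auto
    finally show "measure \<mu> W \<le> \<eta>" using \<open>0 < \<eta>\<close> by (simp add: power2_eq_square)
  qed
  have sXV: "X - ?V \<in> sets (restrict_space borel X)" using sX sV by (rule sets.Diff)
  have sW': "W' \<in> sets \<mu>" unfolding W'_def by (rule measurable_sets[OF M(4) sXV])
  have mW': "measure \<mu> W' \<le> \<eta>" unfolding W'_def using M(5)[OF sXV] K(5) by simp
  define name where "name z = restrict (\<lambda>i. a ((?T ^^ i) z)) {..<n}" for z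
  define Q where "Q = iter_join \<mu> ?T P n"
  define Q' where "Q' = {A \<in> Q. A \<inter> Y \<noteq> {}}"
  \<comment> \<open>Number of codes times the size of a Hamming ball: the bound for the number of
    atoms that meet \<open>Y\<close>.\<close>
  define N where "N = real (Suc m) * (real p ^ L * S_n p g K \<epsilon> L) * (1 + k * t) ^ n / t ^ nat \<lfloor>2 * \<eta> * real n\<rfloor>"
  have S1: "1 \<le> S_n p g K \<epsilon> L" using K \<open>0 < \<epsilon>\<close> by (intro S_n_ge_1) auto
  have finPi: "finite ({..<n} \<rightarrow>\<^sub>E P)" using Pp(1) by (intro finite_PiE) auto
  have "t ^ nat \<lfloor>2 * \<eta> * real n\<rfloor> * real (card (name ` Y))
      \<le> real (Suc m) * (real p ^ L * S_n p g K \<epsilon> L) * (1 + k * t) ^ n"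
    unfolding name_def k_def L_def
  proof (rule card_itineraries_le)
    fix z assume "z \<in> Y"
    then have z: "z \<in> space \<mu>" "z \<notin> W" "z \<notin> W'" by (auto simp: Y_def)
    then show "(\<forall>i. fst z i < p) \<and> snd z \<in> ?V
        \<and> real (card {i. i < n \<and> (?T ^^ i) z \<notin> B}) \<le> \<eta> * real n"
      using M(6)[OF z(1)] by (auto simp: W_def W'_def)
    show "a ((?T ^^ i) z) \<in> P" for i using a_mem[OF Ti[OF z(1)]] by blast
  next
    fix z z' assume *: "z \<in> B" "z' \<in> B" "\<forall>i<m'. fst z i = fst z' i" "dist (snd z) (snd z') \<le> 2 * \<epsilon>"
    have "z \<in> space \<mu>" using *(1) B(1) sets.sets_into_space by blast
    note az = a_mem[OF this]
    have "dist (snd z) (snd z') \<le> \<epsilon>\<^sub>1" using *(4) \<open>2 * \<epsilon> \<le> \<epsilon>\<^sub>1\<close> by linarith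
    then have "z' \<in> a z" using cylinder_constant_onD[OF B(3) *(1-3), of "a z"] az by blast
    then show "a z = a z'" using a_eq[of "a z" z'] az by simp
  qed (use assms Pp in auto)
  then have name_le: "real (card (name ` Y)) \<le> N"
    using \<open>0 < t\<close> by (simp add: N_def pos_le_divide_eq mult.commute)
  have "Q' \<subseteq> (\<lambda>c. space \<mu> \<inter> (\<Inter>i<n. (?T ^^ i) -` c i)) ` name ` Y"
  proof
    fix A assume "A \<in> Q'"
    then obtain c z where c: "c \<in> {..<n} \<rightarrow>\<^sub>E P" "A = space \<mu> \<inter> (\<Inter>i<n. (?T ^^ i) -` c i)" "z \<in> A" "z \<in> Y"
      unfolding Q'_def Q_def iter_join_eq_image by blast
    have "name z i = c i" if "i < n" for i
      using c that a_eq[of "c i" "(?T ^^ i) z"] by (auto simp: name_def)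
    then have "A = space \<mu> \<inter> (\<Inter>i<n. (?T ^^ i) -` name z i)" using c(2) by simp
    then show "A \<in> (\<lambda>c. space \<mu> \<inter> (\<Inter>i<n. (?T ^^ i) -` c i)) ` name ` Y" using c(4) by blast
  qed
  moreover have "finite (name ` Y)"
  proof (rule finite_subset[OF _ finPi])
    show "name ` Y \<subseteq> {..<n} \<rightarrow>\<^sub>E P" using a_mem[OF Ti] by (auto simp: name_def Y_def)
  qed
  ultimately have "card Q' \<le> card (name ` Y)" by (rule surj_card_le[rotated])
  then have Q'N: "real (card Q') \<le> N" using name_le by linarith
  have N1: "1 \<le> N"
  proof -
    have "1 \<le> real (Suc m) * (real p ^ L * S_n p g K \<epsilon> L) * (1 + k * t) ^ n"
      using S1 p_pos k1 \<open>0 < t\<close> by (intro mult_ge1_I one_le_power) auto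
    moreover have "t ^ nat \<lfloor>2 * \<eta> * real n\<rfloor> \<le> 1" using \<open>0 < t\<close> \<open>t \<le> 1\<close> by (intro power_le_one) auto
    ultimately show ?thesis unfolding N_def using \<open>0 < t\<close> by (simp add: pos_le_divide_eq)
  qed
  have "card Q \<le> card ({..<n} \<rightarrow>\<^sub>E P)" unfolding Q_def iter_join_eq_image by (rule card_image_le[OF finPi])
  then have QC: "real (card Q) \<le> k ^ n" by (simp add: card_PiE k_def flip: of_nat_power)
  \<comment> \<open>An atom outside \<open>Q'\<close> contains no good point, so it lies entirely in
    the excluded set.\<close>
  have "measure \<mu> (\<Union>(Q - Q')) \<le> measure \<mu> (W \<union> W')"
  proof (rule finite_measure_mono)
    show "\<Union>(Q - Q') \<subseteq> W \<union> W'"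
      unfolding Q'_def Y_def Q_def iter_join_def by blast
  qed (use sW sW' in auto)
  also have "\<dots> \<le> measure \<mu> W + measure \<mu> W'" by (rule measure_Un_le[OF sW sW'])
  also have "\<dots> \<le> 2 * \<eta>" using mW mW' by simp
  finally have rest: "measure \<mu> (\<Union>(Q - Q')) \<le> 2 * \<eta>" .
  have "partition_entropy \<mu> Q \<le> ln 2 + ln N + 2 * \<eta> * ln (k ^ n)"
  proof (rule partition_entropy_le_card[OF M(1) _ _ Q'N N1 QC _ rest])
    show "finite_partition \<mu> Q" unfolding Q_def by (rule finite_partition_iter_join[OF P T])
    show "Q' \<subseteq> Q" by (auto simp: Q'_def)
    show "1 \<le> k ^ n" using k1 by simp
  qed
  moreover have "ln N \<le> ln (real (Suc m)) + real L * ln (real p) + ln (S_n p g K \<epsilon> L)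
      + real n * (k * t + 2 * \<eta> * ln (1 / t))"
  proof -
    have pos: "0 < S_n p g K \<epsilon> L" "0 < real p" "0 < 1 + k * t" using S1 p_pos k1 \<open>0 < t\<close> by (auto intro: add_pos_nonneg)
    have "ln N = ln (real (Suc m)) + (real L * ln (real p) + ln (S_n p g K \<epsilon> L)) + real n * ln (1 + k * t)
        - real (nat \<lfloor>2 * \<eta> * real n\<rfloor>) * ln t"
      unfolding N_def using pos \<open>0 < t\<close>
      by (simp add: ln_div ln_mult ln_realpow del: of_nat_Suc)
    moreover have "real n * ln (1 + k * t) \<le> real n * (k * t)"
      using k1 \<open>0 < t\<close> by (intro mult_left_mono ln_add_one_self_le_self) auto
    moreover have "real (nat \<lfloor>2 * \<eta> * real n\<rfloor>) * ln (1 / t) \<le> (2 * \<eta> * real n) * ln (1 / t)"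
      using \<open>0 < \<eta>\<close> \<open>0 < t\<close> \<open>t \<le> 1\<close> by (intro mult_right_mono) (auto simp: ln_div)
    ultimately show ?thesis using \<open>0 < t\<close> by (simp add: ln_div algebra_simps)
  qed
  ultimately show ?thesis unfolding Q_def using k1 by (simp add: ln_realpow algebra_simps)
qed

section \<open>Lower bound for \<open>S_d\<close>, uniform in K\<close>

lemma compact_subset_positive_measure:
  assumes "prob_space \<nu>" "sets \<nu> = sets (restrict_space borel X)" "K \<in> sets \<nu>" "0 < measure \<nu> K"
  shows "\<exists>F. compact F \<and> F \<subseteq> K \<and> 0 < measure \<nu> F"
proof -
  interpret prob_space \<nu> by fact
  have X: "X \<in> sets borel" using compact by (simp add: borel_closed compact_imp_closed)
  have K: "K \<subseteq> X" "K \<in> sets borel" using assms(2,3) X by (auto simp: sets_restrict_space_iff)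
  have spX: "space \<nu> = X" using sets_eq_imp_space_eq[OF assms(2)] by (simp add: space_restrict_space)
  have id: "(\<lambda>x. x) \<in> measurable \<nu> borel"
    unfolding measurable_cong_sets[OF assms(2) refl] by (simp add: measurable_restrict_space1)
  \<comment> \<open>The regularity lemma concerns measures on all Borel sets of the ambient type, so
    \<nu> is pushed forward to them.\<close>
  let ?M = "distr \<nu> borel (\<lambda>x. x)"
  have M: "measure ?M A = measure \<nu> (A \<inter> X)" if "A \<in> sets borel" for A
    using measure_distr[OF id that] by (simp add: spX)
  \<comment> \<open>Accuracy \<nu>(K) is already enough: the part of K outside C then has measure
    less than \<nu>(K), so C has positive measure. It is compact as a closed subset of X.\<close>
  have "\<exists>C U. closed C \<and> open U \<and> C \<subseteq> K \<and> K \<subseteq> U \<and> measure ?M (U - C) < measure \<nu> K"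
    by (rule borel_closed_open_approx) (use K assms(4) in \<open>auto intro: finite_measure_distr[OF id]\<close>)
  then obtain C U where C: "closed C" "open U" "C \<subseteq> K" "K \<subseteq> U" "measure ?M (U - C) < measure \<nu> K"
    by blast
  have CX: "C \<inter> X = C" using C(3) K(1) by blast
  have "compact (X \<inter> C)" using compact C(1) by (rule compact_Int_closed)
  then have cC: "compact C" using CX by (simp add: Int_commute)
  have sC: "C \<in> sets \<nu>" using sets_compact[OF cC] C(3) K(1) assms(2) by auto
  have sUC: "(U - C) \<inter> X \<in> sets \<nu>"
    using C X by (simp add: assms(2) sets_restrict_space_iff borel_closed borel_open)
  have "measure \<nu> K \<le> measure \<nu> (C \<union> (U - C) \<inter> X)"
    using sC sUC C(4) K(1) by (intro finite_measure_mono) auto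
  also have "\<dots> \<le> measure \<nu> C + measure \<nu> ((U - C) \<inter> X)" by (rule measure_Un_le[OF sC sUC])
  also have "measure \<nu> ((U - C) \<inter> X) < measure \<nu> K"
    using C(5) M[of "U - C"] C(1,2) by (simp add: borel_closed borel_open)
  finally have "0 < measure \<nu> C" by simp
  then show ?thesis using cC C(3) by blast
qed

text \<open>The order of choices carries the uniformity: t, \<eta>, the good set B, m' and
  \<open>\<epsilon>\<^sub>1\<close> depend on \<mu>, P and \<delta> alone. Only afterwards does K
  produce F and m, which affect just the terms that stay bounded in n.\<close>

lemma S_d_ge_entropy:
  assumes erg: "Pi_erg p X g \<nu> \<noteq> {}" and \<nu>: "prob_space \<nu>" "sets \<nu> = sets (restrict_space borel X)"
    and \<mu>: "\<mu> \<in> Pi_set p X g \<nu>" and P: "finite_partition \<mu> P" and "0 < \<delta>"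
  shows "\<exists>\<epsilon>\<^sub>0>0. \<forall>\<epsilon>. 0 < \<epsilon> \<longrightarrow> \<epsilon> \<le> \<epsilon>\<^sub>0 \<longrightarrow> (\<forall>K\<in>sets \<nu>. 0 < measure \<nu> K \<longrightarrow>
     ereal (entropy_wrt \<mu> (skew_map g) P - ln (real p) - \<delta>) \<le> S_d p g K \<epsilon>)"
proof -
  let ?T = "skew_map g"
  note M = Pi_setD[OF \<mu>]
  interpret prob_space \<mu> by (rule M(1))
  define k where "k = real (card P)"
  have "finite P" "\<Union>P = space \<mu>" "P \<subseteq> sets \<mu>" using P by (auto simp: finite_partition_def)
  then have "P \<noteq> {}" using not_empty by auto
  then have k1: "1 \<le> k" using \<open>finite P\<close> by (simp add: k_def Suc_le_eq card_gt_0_iff)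
  \<comment> \<open>Makes the growth of the Hamming weights cost at most \<delta>/4 per
    symbol.\<close>
  define t where "t = min 1 (\<delta> / (4 * k))"
  have t: "0 < t" "t \<le> 1" "k * t \<le> \<delta> / 4"
  proof -
    show "0 < t" "t \<le> 1" using k1 \<open>0 < \<delta>\<close> by (auto simp: t_def)
    have "k * t \<le> k * (\<delta> / (4 * k))" using k1 by (intro mult_left_mono) (auto simp: t_def)
    then show "k * t \<le> \<delta> / 4" using k1 by simp
  qed
  define c where "c = ln (1 / t) + ln k"
  have c0: "0 \<le> c" using t k1 by (simp add: c_def)
  \<comment> \<open>Makes the two terms linear in \<eta> cost at most \<delta>/4 together. With the
    choice of t this uses \<delta>/2, and the other half of \<delta> is the margin for the
    contradiction. Adding 1 to c avoids division by 0.\<close>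
  define \<eta> where "\<eta> = \<delta> / (8 * (c + 1))"
  have \<eta>: "0 < \<eta>" "2 * \<eta> * c \<le> \<delta> / 4"
  proof -
    show "0 < \<eta>" using c0 \<open>0 < \<delta>\<close> by (simp add: \<eta>_def)
    have "2 * \<eta> * c \<le> 2 * \<eta> * (c + 1)" using \<open>0 < \<eta>\<close> by simp
    also have "\<dots> = \<delta> / 4" using c0 by (simp add: \<eta>_def field_simps)
    finally show "2 * \<eta> * c \<le> \<delta> / 4" .
  qed
  have approx: "approximable \<mu> P"
  proof (rule approximable_finite[OF finite_measure_axioms \<open>finite P\<close>])
    fix A assume "A \<in> P"
    then have "A \<in> sets \<mu>" using \<open>P \<subseteq> sets \<mu>\<close> by blast
    then show "approximable \<mu> {A}" by (rule approximable_skew_space[OF finite_measure_axioms M(2)])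
  qed
  have "0 < \<eta>\<^sup>2" using \<eta> by simp
  from approx[unfolded approximable_def, rule_format, OF this] obtain B m' \<epsilon>\<^sub>1 where B: "B \<in> sets \<mu>" "0 < \<epsilon>\<^sub>1" "measure \<mu> (space \<mu> - B) < \<eta>\<^sup>2"
    "cylinder_constant_on B m' \<epsilon>\<^sub>1 P"
    by blast
  define h where "h = entropy_wrt \<mu> ?T P"
  have main: "ereal (h - ln (real p) - \<delta>) \<le> S_d p g K \<epsilon>"
    if \<epsilon>: "0 < \<epsilon>" "\<epsilon> \<le> \<epsilon>\<^sub>1 / 2" and K: "K \<in> sets \<nu>" "0 < measure \<nu> K" for \<epsilon> K
  proof (rule ccontr)
    \<comment> \<open>If the limsup were below s, then ln \<open>S_n\<close> would eventually be
      below s n, and the entropy estimate would give h \<le> ln p + s + \<delta>/2 = h -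
      \<delta>/2.\<close>
    define s where "s = h - ln (real p) - \<delta>"
    assume "\<not> ereal (h - ln (real p) - \<delta>) \<le> S_d p g K \<epsilon>"
    then have "limsup (\<lambda>n. ereal (ln (S_n p g K \<epsilon> n) / real n)) < ereal s"
      by (simp add: S_d_def s_def)
    then have "\<forall>\<^sub>F n in sequentially. ereal (ln (S_n p g K \<epsilon> n) / real n) < ereal s"
      by (rule Limsup_lessD)
    then obtain n0 where n0: "\<And>n. n \<ge> n0 \<Longrightarrow> ln (S_n p g K \<epsilon> n) / real n < s"
      by (auto simp: eventually_sequentially)
    obtain F where F: "compact F" "F \<subseteq> K" "0 < measure \<nu> F"
      using compact_subset_positive_measure[OF \<nu> K] by blast
    have KX: "K \<subseteq> X" using K(1) sets.sets_into_space[OF K(1)] sets_eq_imp_space_eq[OF \<nu>(2)]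
      by (simp add: space_restrict_space)
    have "F \<noteq> {}" using F(3) by auto
    obtain \<mu>' where "\<mu>' \<in> Pi_erg p X g \<nu>" using erg by blast
    from word_images_exhaust[OF this \<nu> F(1) _ F(3) \<eta>(1)] F(2) KX
    obtain m where m: "measure \<nu> (X - word_images p g F m) < \<eta>" by blast
    define M where "M = m' + m"
    \<comment> \<open>Everything independent of n, including the share of the extra word length in
      ln p and in s. It depends on K through m, but is divided by n.\<close>
    define C where "C = ln 2 + ln (real (Suc m)) + real M * ln (real p) + real M * s"
    have bound: "partition_entropy \<mu> (iter_join \<mu> ?T P n) / real n \<le> ln (real p) + s + \<delta> / 2 + C / real n"
      if n: "n \<ge> max 1 n0" for n
    proof -
      define L where "L = n + m' + m"
      have L: "real L = real n + real M" "L \<ge> n0" "0 < L" using n by (auto simp: L_def M_def)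
      have "partition_entropy \<mu> (iter_join \<mu> ?T P n)
        \<le> ln 2 + ln (real (Suc m)) + real L * ln (real p) + ln (S_n p g K \<epsilon> L)
          + real n * (k * t + 2 * \<eta> * ln (1 / t) + 2 * \<eta> * ln k)"
        unfolding L_def k_def
        by (rule partition_entropy_iter_join_le[OF \<mu> P B(1) _ B(4) KX F(2)])
          (use B(3) F m t \<epsilon> \<eta> n \<open>F \<noteq> {}\<close> in auto)
      moreover have "ln (S_n p g K \<epsilon> L) \<le> s * real L"
        using n0[OF L(2)] L(3) by (simp add: pos_divide_less_eq)
      moreover have "real n * (k * t + 2 * \<eta> * ln (1 / t) + 2 * \<eta> * ln k) \<le> real n * (\<delta> / 2)"
        using t(3) \<eta>(2) by (intro mult_left_mono) (auto simp: c_def distrib_left)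
      ultimately have "partition_entropy \<mu> (iter_join \<mu> ?T P n) \<le> real n * (ln (real p) + s + \<delta> / 2) + C"
        unfolding C_def L(1) by (simp add: algebra_simps)
      then have "partition_entropy \<mu> (iter_join \<mu> ?T P n) / real n \<le> (real n * (ln (real p) + s + \<delta> / 2) + C) / real n"
        by (rule divide_right_mono) simp
      also have "\<dots> = ln (real p) + s + \<delta> / 2 + C / real n" using n by (simp add: add_divide_distrib)
      finally show ?thesis .
    qed
    have "(\<lambda>n. ln (real p) + s + \<delta> / 2 + C / real n) \<longlonglongrightarrow> ln (real p) + s + \<delta> / 2 + 0"
      by (intro tendsto_intros lim_const_over_n)
    moreover have "\<exists>N. \<forall>n\<ge>N. partition_entropy \<mu> (iter_join \<mu> ?T P n) / real n
        \<le> ln (real p) + s + \<delta> / 2 + C / real n" using bound by blast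
    ultimately have "entropy_wrt \<mu> ?T P \<le> ln (real p) + s + \<delta> / 2 + 0"
      by (rule LIMSEQ_le[OF entropy_wrt_LIMSEQ[OF M(1,3) P]])
    then have "h \<le> ln (real p) + s + \<delta> / 2" by (simp add: h_def)
    then show False using \<open>0 < \<delta>\<close> by (simp add: s_def)
  qed
  \<comment> \<open>Equal codes bring orbits only within 2 \<epsilon> of each other, hence the
    threshold \<open>\<epsilon>\<^sub>1 / 2\<close>.\<close>
  show ?thesis
    using main B(2) unfolding h_def by (intro exI[of _ "\<epsilon>\<^sub>1 / 2"]) auto
qed

text \<open>Unfolds both suprema, so that one measure, one partition and one \<delta> can be treated
  at a time. As y may be infinite, the finite term ln p is moved across the inequality before
  suprema are taken.\<close>

lemma h_nu_le:
  assumes "\<And>\<mu> P \<delta>. \<mu> \<in> Pi_set p X g \<nu> \<Longrightarrow> finite_partition \<mu> P \<Longrightarrow> 0 < \<delta> \<Longrightarrow>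
    ereal (entropy_wrt \<mu> (skew_map g) P - ln (real p) - \<delta>) \<le> y"
  shows "h_nu p X g \<nu> \<le> y"
proof -
  have "ereal (entropy_wrt \<mu> (skew_map g) P) \<le> y + ereal (ln (real p))"
    if "\<mu> \<in> Pi_set p X g \<nu>" "finite_partition \<mu> P" for \<mu> P
  proof (rule ereal_le_epsilon2)
    fix \<delta> :: real assume "0 < \<delta>"
    from assms[OF that this] show "ereal (entropy_wrt \<mu> (skew_map g) P) \<le> y + ereal (ln (real p)) + ereal \<delta>"
      by (cases y) auto
  qed
  then have "(SUP \<mu>\<in>Pi_set p X g \<nu>. ks_entropy \<mu> (skew_map g)) \<le> y + ereal (ln (real p))"
    unfolding ks_entropy_def by (intro SUP_least) auto
  then show ?thesis unfolding h_nu_def by (simp add: ereal_minus_le)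
qed

end

theorem theoremB:
  fixes X :: "'a::metric_space set" and p :: nat and g :: "nat \<Rightarrow> 'a \<Rightarrow> 'a"
    and \<nu> :: "'a measure"
  assumes "compact X"
    and "p \<ge> 1"
    and "\<And>i. i < p \<Longrightarrow> continuous_on X (g i)"
    and "\<And>i. i < p \<Longrightarrow> g i ` X \<subseteq> X"
    and "prob_space \<nu>" and "sets \<nu> = sets (restrict_space borel X)"
    and "Pi_erg p X g \<nu> \<noteq> {}"
  shows "Liminf (at_right 0)
           (\<lambda>\<epsilon>. INF K\<in>{K\<in>sets \<nu>. measure \<nu> K > 0}. S_d p g K \<epsilon>) \<ge> h_nu p X g \<nu>
       \<and> (\<forall>K\<in>sets \<nu>. measure \<nu> K > 0 \<longrightarrow> h_top p g K \<ge> h_nu p X g \<nu>)"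
proof -
  interpret semigroup_action X p g by standard (fact assms)+
  note ge = S_d_ge_entropy[OF assms(7,5,6)]
  have "h_nu p X g \<nu> \<le> Liminf (at_right 0)
      (\<lambda>\<epsilon>. INF K\<in>{K\<in>sets \<nu>. measure \<nu> K > 0}. S_d p g K \<epsilon>)"
  proof (rule h_nu_le)
    fix \<mu> P and \<delta> :: real assume "\<mu> \<in> Pi_set p X g \<nu>" "finite_partition \<mu> P" "0 < \<delta>"
    from ge[OF this] obtain e where e: "e > 0" "\<And>\<epsilon> K. 0 < \<epsilon> \<Longrightarrow> \<epsilon> \<le> e \<Longrightarrow> K \<in> sets \<nu> \<Longrightarrow> 0 < measure \<nu> K \<Longrightarrow>
        ereal (entropy_wrt \<mu> (skew_map g) P - ln (real p) - \<delta>) \<le> S_d p g K \<epsilon>" by blast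
    have "\<forall>\<^sub>F \<epsilon> in at_right 0. \<epsilon> < e" "\<forall>\<^sub>F \<epsilon> in at_right (0::real). 0 < \<epsilon>"
      using e(1) by (auto intro: eventually_at_right_less order_tendstoD(2)[OF tendsto_ident_at])
    \<comment> \<open>The threshold e does not depend on K, so for each fixed \<epsilon> below it
      the bound passes to the infimum over K.\<close>
    then have "\<forall>\<^sub>F \<epsilon> in at_right 0. ereal (entropy_wrt \<mu> (skew_map g) P - ln (real p) - \<delta>)
        \<le> (INF K\<in>{K\<in>sets \<nu>. measure \<nu> K > 0}. S_d p g K \<epsilon>)"
      by eventually_elim (auto intro!: INF_greatest e(2))
    then show "ereal (entropy_wrt \<mu> (skew_map g) P - ln (real p) - \<delta>)
        \<le> Liminf (at_right 0) (\<lambda>\<epsilon>. INF K\<in>{K\<in>sets \<nu>. measure \<nu> K > 0}. S_d p g K \<epsilon>)"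
      by (rule Liminf_bounded)
  qed
  \<comment> \<open>One admissible radius suffices for a given K, because \<open>h_top\<close>
    dominates \<open>S_d\<close> at every positive \<epsilon>.\<close>
  moreover have "h_nu p X g \<nu> \<le> h_top p g K" if K: "K \<in> sets \<nu>" "measure \<nu> K > 0" for K
  proof (rule h_nu_le)
    fix \<mu> P and \<delta> :: real assume "\<mu> \<in> Pi_set p X g \<nu>" "finite_partition \<mu> P" "0 < \<delta>"
    from ge[OF this] obtain e where e: "e > 0"
      "ereal (entropy_wrt \<mu> (skew_map g) P - ln (real p) - \<delta>) \<le> S_d p g K e" using K by blast
    have "K \<subseteq> X" using sets.sets_into_space[OF K(1)] sets_eq_imp_space_eq[OF assms(6)]
      by (simp add: space_restrict_space)
    moreover have "K \<noteq> {}" using K(2) by auto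
    ultimately have "S_d p g K e \<le> h_top p g K" using e(1) by (intro h_top_ge_S_d)
    then show "ereal (entropy_wrt \<mu> (skew_map g) P - ln (real p) - \<delta>) \<le> h_top p g K"
      using e(2) by order
  qed
  ultimately show ?thesis by blast
qed

end
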